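(* Let $(z_k)_{k\in\mathbb{N}}$ be a sequence of positive deterministic real numbers, nondecreasing in $k$, with $z_n\to\infty$ as $n\to\infty$, and let $(X_k)_{k\in\mathbb{N}}$ be independent random variables with values in $\mathbb{N}_0=\{0,1,2,\dots\}$. Put $q_k^0=\mathbf{P}\{X_k=0\}$ and $q_k^1=\mathbf{P}\{X_k=1\}$, and consider the point processes $\nu_n=\sum_{k=1}^\infty X_k\delta_{z_k/z_n}$, $n\in\mathbb{N}$, on $(0,\infty)$. Then $(\nu_n)_{n\in\mathbb{N}}$ converges vaguely in distribution to $\eta_c$ for some $c>0$ as $n\to\infty$ if and only if the following condition holds: there exists $c>0$ such that for all $0<a<b<\infty$, (i) $\prod_{k:\, a z_n<z_k\le b z_n} q_k^0\to (a/b)^c$ as $n\to\infty$, and (ii) $\liminf_{n\to\infty}\sum_{k:\, a z_n<z_k\le b z_n} q_k^1/q_k^0\ge c\log(b/a)$ (with the same constant $c$ in the limit process $\eta_c$ and in the condition).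
   Context: $\delta_x$ is the Dirac measure at $x$. For $c>0$, $\eta_c$ denotes the Poisson process on $(0,\infty)$ with intensity measure $c t^{-1}\,dt$ (the scale-invariant Poisson process). A point process is a random locally finite counting measure. Point processes $\xi_n$ on a locally compact separable metric space $S$ converge vaguely in distribution to $\xi$ if they converge in distribution as random elements of the space of locally finite measures on $S$ with the vague topology; equivalently, $\int f\,d\xi_n\to\int f\,d\xi$ in distribution for every bounded non-negative continuous $f$ on $S$ with relatively compact support. Here $S=(0,\infty)$ (relatively compact sets are those bounded away from $0$ and $\infty$). *)

theory Defs
  imports "HOL-Probability.Probability"
begin

text \<open>
  Measures on a locally compact separable metric space \<open>S\<close>, which is given as a subset of a
  metric-space type. They live on the trace sigma-algebra, so that \<open>space \<mu> = S\<close>.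
  Compactness of \<open>K \<subseteq> S\<close> in the ambient space and in \<open>S\<close> coincide.
\<close>

definition relcompact_borel :: "'a::metric_space set \<Rightarrow> 'a set set" where
  "relcompact_borel S =
     {B \<in> sets (restrict_space borel S). \<exists>K. compact K \<and> K \<subseteq> S \<and> B \<subseteq> K}"

definition locally_finite_measures :: "'a::metric_space set \<Rightarrow> 'a measure set" where
  "locally_finite_measures S =
     {\<mu>. space \<mu> = S \<and> sets \<mu> = sets (restrict_space borel S) \<and>
         (\<forall>B\<in>relcompact_borel S. emeasure \<mu> B < \<infinity>)}"

definition locally_finite_counting_measures :: "'a::metric_space set \<Rightarrow> 'a measure set" where
  "locally_finite_counting_measures S =
     {\<mu> \<in> locally_finite_measures S. \<forall>B\<in>relcompact_borel S. \<exists>m::nat. emeasure \<mu> B = of_nat m}"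

text \<open>
  Boundedness of the test functions is automatic. Their values outside \<open>S\<close> are irrelevant, since
  they are only integrated against measures on \<open>S\<close>.
\<close>

definition vague_test_functions :: "'a::metric_space set \<Rightarrow> ('a \<Rightarrow> real) set" where
  "vague_test_functions S =
     {f. continuous_on S f \<and> (\<forall>x\<in>S. 0 \<le> f x) \<and>
         (\<exists>K. compact K \<and> K \<subseteq> S \<and> (\<forall>x\<in>S - K. f x = 0))}"

definition vague_topology :: "'a::metric_space set \<Rightarrow> 'a measure topology" where
  "vague_topology S = topology_generated_by
     {{\<mu> \<in> locally_finite_measures S. (\<integral>x. f x \<partial>\<mu>) \<in> U} | f U.
        f \<in> vague_test_functions S \<and> open U}"

text \<open>
  Measurability of a random measure refers to the sigma-algebra generated by the evaluations
  \<open>\<mu> \<mapsto> \<mu> B\<close>, which is the Borel sigma-algebra of the vague topology.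
\<close>

definition point_process ::
    "'w measure \<Rightarrow> 'a::metric_space set \<Rightarrow> ('w \<Rightarrow> 'a measure) \<Rightarrow> bool" where
  "point_process M S \<xi> \<longleftrightarrow>
     prob_space M \<and>
     (\<forall>\<omega>\<in>space M. \<xi> \<omega> \<in> locally_finite_counting_measures S) \<and>
     (\<forall>B\<in>sets (restrict_space borel S). (\<lambda>\<omega>. emeasure (\<xi> \<omega>) B) \<in> borel_measurable M)"

text \<open>
  Convergence in distribution as random elements of the space of locally finite measures with the
  vague topology. The processes may be defined on different probability spaces.
\<close>

definition converges_vaguely_in_distribution ::
    "'a::metric_space set \<Rightarrow> (nat \<Rightarrow> 'v measure) \<Rightarrow> (nat \<Rightarrow> 'v \<Rightarrow> 'a measure) \<Rightarrow>
     'w measure \<Rightarrow> ('w \<Rightarrow> 'a measure) \<Rightarrow> bool" where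
  "converges_vaguely_in_distribution S M \<xi> N \<eta> \<longleftrightarrow>
     (\<forall>g. continuous_map (vague_topology S) euclideanreal g \<and>
          bounded (g ` locally_finite_measures S) \<longrightarrow>
          (\<lambda>n. \<integral>\<omega>. g (\<xi> n \<omega>) \<partial>M n) \<longlonglongrightarrow> (\<integral>\<omega>. g (\<eta> \<omega>) \<partial>N))"

definition poisson_process ::
    "'w measure \<Rightarrow> 'a::metric_space set \<Rightarrow> 'a measure \<Rightarrow> ('w \<Rightarrow> 'a measure) \<Rightarrow> bool" where
  "poisson_process M S \<mu> \<xi> \<longleftrightarrow>
     \<mu> \<in> locally_finite_measures S \<and>
     point_process M S \<xi> \<and>
     (\<forall>B\<in>relcompact_borel S. \<forall>m::nat.
        \<P>(\<omega> in M. emeasure (\<xi> \<omega>) B = of_nat m) =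
          measure \<mu> B ^ m / fact m * exp (- measure \<mu> B)) \<and>
     (\<forall>(I::nat set) B. finite I \<and> B ` I \<subseteq> relcompact_borel S \<and> disjoint_family_on B I \<longrightarrow>
        prob_space.indep_vars M (\<lambda>_. borel) (\<lambda>i \<omega>. emeasure (\<xi> \<omega>) (B i)) I)"

definition scale_invariant_intensity :: "real \<Rightarrow> real measure" where
  "scale_invariant_intensity c = density (restrict_space lborel {0<..}) (\<lambda>t. ennreal (c / t))"

text \<open>The measure \<open>\<Sum>k. w k \<delta>\<^bsub>x k\<^esub>\<close> on \<open>S\<close>.\<close>

definition dirac_series :: "'a::metric_space set \<Rightarrow> (nat \<Rightarrow> nat) \<Rightarrow> (nat \<Rightarrow> 'a) \<Rightarrow> 'a measure" where
  "dirac_series S w x = measure_of S (sets (restrict_space borel S))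
     (\<lambda>B. \<Sum>k. of_nat (w k) * indicator B (x k))"

definition scaled_process ::
    "(nat \<Rightarrow> real) \<Rightarrow> (nat \<Rightarrow> 'w \<Rightarrow> nat) \<Rightarrow> nat \<Rightarrow> 'w \<Rightarrow> real measure" where
  "scaled_process z X n \<omega> = dirac_series {0<..} (\<lambda>k. X k \<omega>) (\<lambda>k. z k / z n)"

text \<open>
  If \<open>q\<^sup>0\<^sub>k = 0\<close>, the quotient below is \<open>0\<close>. This affects nothing: by the first condition,
  for all large \<open>n\<close> no such \<open>k\<close> occurs in the sum. The index sets are finite when \<open>z\<close> tends to
  infinity.
\<close>

definition poisson_limit_condition ::
    "'w measure \<Rightarrow> (nat \<Rightarrow> real) \<Rightarrow> (nat \<Rightarrow> 'w \<Rightarrow> nat) \<Rightarrow> real \<Rightarrow> bool" where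
  "poisson_limit_condition M z X c \<longleftrightarrow>
     (\<forall>a b. 0 < a \<and> a < b \<longrightarrow>
        ((\<lambda>n. \<Prod>k | a * z n < z k \<and> z k \<le> b * z n. \<P>(\<omega> in M. X k \<omega> = 0))
           \<longlonglongrightarrow> (a / b) powr c) \<and>
        liminf (\<lambda>n. ereal (\<Sum>k | a * z n < z k \<and> z k \<le> b * z n.
             \<P>(\<omega> in M. X k \<omega> = 1) / \<P>(\<omega> in M. X k \<omega> = 0)))
          \<ge> ereal (c * ln (b / a)))"

end

theory Submission
  imports Defs
begin

text \<open>
  Write \<open>r = c ln (b / a)\<close>. By independence, the number of points of \<open>\<nu>\<^sub>n\<close> in \<open>{a<..b}\<close> is \<open>0\<close> with
  probability \<open>p\<^sub>n = \<Prod> q\<^sup>0\<^sub>k\<close>, and \<open>1\<close> with probability \<open>p\<^sub>n * (\<Sum> q\<^sup>1\<^sub>k / q\<^sup>0\<^sub>k)\<close> if \<open>p\<^sub>n \<noteq> 0\<close>, where \<open>k\<close>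
  ranges over the indices with \<open>a z\<^sub>n < z\<^sub>k \<le> b z\<^sub>n\<close>. The two conditions therefore say that these
  probabilities have limit \<open>exp (-r)\<close> and lower limit at least \<open>r exp (-r)\<close>, the probabilities of
  \<open>0\<close> and \<open>1\<close> under the Poisson distribution with parameter \<open>r\<close>.

  Necessity follows by approximation: the indicator of at most \<open>k\<close> points in an interval is squeezed
  between continuous functionals of the process (\<open>convergence_at_most\<close>).

  For sufficiency, cut a large window into
  cells of logarithmic length \<open>2\<^sup>-\<^sup>m\<close> and record the number of points in each. Two counting measures
  with equal counts integrate a test function to almost the same value, so a vaguely
  continuous \<open>g\<close> is the limit, as \<open>m\<close> grows, of its infimum over the measures with given counts
  (\<open>grid_lower_LIMSEQ\<close>). This reduces a lower bound for the lower limit of the expectations of \<open>g\<close>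
  to one for the probabilities of individual count vectors. The limit process has with high
  probability at most one point in each cell of a fine grid, so zero-one vectors suffice, and by
  independence of disjoint cells their probabilities are products of the probabilities of \<open>0\<close> and
  \<open>1\<close> in single cells, which the two conditions control. As the bound holds for \<open>g\<close> and \<open>-g\<close> up to
  constants, the expectations converge (\<open>converges_vaguely_if_grid_counts\<close>).
\<close>

section \<open>A logarithmic grid on the half-line\<close>

text \<open>
  The grid of level \<open>m\<close> cuts the window \<open>{exp (-m) <.. exp m}\<close> into cells of logarithmic length
  \<open>2\<^sup>-\<^sup>m\<close>. Every cell then carries the same mass \<open>c / 2 ^ m\<close> of the scale-invariant intensity, and
  each smaller window \<open>{exp (-m\<^sub>0) <.. exp m\<^sub>0}\<close> with \<open>m\<^sub>0 \<le> m\<close> is a union of cells. The mesh must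
  decrease faster than the inverse of the window length: the expected number of cells with two or
  more points is of order \<open>m 2\<^sup>m (c / 2\<^sup>m)\<^sup>2\<close>, and this has to vanish.
\<close>

definition grid_point :: "nat \<Rightarrow> nat \<Rightarrow> real" where
  "grid_point m j = exp (real j / 2 ^ m - real m)"

definition grid_cell :: "nat \<Rightarrow> nat \<Rightarrow> real set" where
  "grid_cell m j = {grid_point m j <.. grid_point m (Suc j)}"

definition grid_size :: "nat \<Rightarrow> nat" where
  "grid_size m = 2 * m * 2 ^ m"

text \<open>
  Counts are stored as a list of natural numbers, an element of a countable type, so that every
  function of them is measurable. On counting measures the rounding changes nothing.
\<close>

definition grid_counts :: "nat \<Rightarrow> real measure \<Rightarrow> nat list" where
  "grid_counts m \<mu> = map (\<lambda>j. nat \<lfloor>measure \<mu> (grid_cell m j)\<rfloor>) [0..<grid_size m]"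

lemma grid_point_pos: "0 < grid_point m j"
  by (simp add: grid_point_def)

lemma grid_point_mono: "i \<le> j \<Longrightarrow> grid_point m i \<le> grid_point m j"
  by (simp add: grid_point_def divide_right_mono)

lemma grid_point_less_Suc: "grid_point m j < grid_point m (Suc j)"
  by (simp add: grid_point_def divide_strict_right_mono)

lemma disjoint_family_grid_cell: "disjoint_family (grid_cell m)"
proof -
  have "grid_cell m i \<inter> grid_cell m j = {}" if "i < j" for i j
    using grid_point_mono[of "Suc i" j m] that by (auto simp: grid_cell_def)
  then show ?thesis
    unfolding disjoint_family_on_def by (metis Int_commute linorder_neqE_nat)
qed

lemma Union_grid_cell:
  assumes "p \<le> q" shows "(\<Union>j\<in>{p..<q}. grid_cell m j) = {grid_point m p <.. grid_point m q}"
  using assms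
proof (induction q rule: dec_induct)
  case base
  then show ?case by simp
next
  case (step q)
  have "(\<Union>j\<in>{p..<Suc q}. grid_cell m j) = {grid_point m p <.. grid_point m q} \<union> grid_cell m q"
    using step by (simp add: atLeastLessThanSuc Un_commute)
  also have "\<dots> = {grid_point m p <.. grid_point m (Suc q)}"
    using grid_point_mono[OF step(1), of m] grid_point_less_Suc[of m q]
    by (auto simp: grid_cell_def)
  finally show ?case .
qed

lemma grid_window:
  assumes "m0 \<le> m"
  shows "grid_point m ((m - m0) * 2 ^ m) = exp (- real m0)"
    and "grid_point m ((m + m0) * 2 ^ m) = exp (real m0)"
    and "(m + m0) * 2 ^ m \<le> grid_size m"
  using assms by (auto simp: grid_point_def grid_size_def)

lemma ln_grid_ratio: "ln (grid_point m (Suc j) / grid_point m j) = 1 / 2 ^ m"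
  unfolding grid_point_def by (simp flip: exp_diff) (simp add: add_divide_distrib)

lemma grid_cell_length: "grid_point m (Suc j) - grid_point m j \<le> grid_point m (Suc j) / 2 ^ m"
proof -
  have "grid_point m j = grid_point m (Suc j) * exp (- (1 / 2 ^ m))"
    unfolding grid_point_def by (simp flip: exp_add) (simp add: add_divide_distrib)
  also have "\<dots> \<ge> grid_point m (Suc j) * (1 - 1 / 2 ^ m)"
    using exp_ge_add_one_self[of "- (1 / 2 ^ m)"] grid_point_pos[of m "Suc j"]
    by (intro mult_left_mono) auto
  finally show ?thesis by (simp add: algebra_simps)
qed

section \<open>Grid counts determine the vague topology\<close>

lemma locally_finite_measuresD:
  assumes "\<mu> \<in> locally_finite_measures S"
  shows "space \<mu> = S" "sets \<mu> = sets (restrict_space borel S)"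
    "B \<in> relcompact_borel S \<Longrightarrow> emeasure \<mu> B < \<infinity>"
  using assms by (auto simp: locally_finite_measures_def)

lemma counting_imp_locally_finite:
  "\<mu> \<in> locally_finite_counting_measures S \<Longrightarrow> \<mu> \<in> locally_finite_measures S"
  by (simp add: locally_finite_counting_measures_def)

lemma relcompact_borelD: "B \<in> relcompact_borel S \<Longrightarrow> B \<in> sets (restrict_space borel S)"
  by (simp add: relcompact_borel_def)

lemma relcompact_interval:
  fixes a b :: real
  assumes "0 < a" shows "{a<..b} \<in> relcompact_borel {0<..}"
proof -
  have "{a<..b} \<in> sets (restrict_space borel {0<..})"
    using assms by (subst sets_restrict_space_iff) auto
  moreover have "compact {a..b}" "{a..b} \<subseteq> {0<..}" "{a<..b} \<subseteq> {a..b}"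
    using assms by auto
  ultimately show ?thesis unfolding relcompact_borel_def by blast
qed

lemma relcompact_grid_cell: "grid_cell m j \<in> relcompact_borel {0<..}"
  unfolding grid_cell_def by (rule relcompact_interval[OF grid_point_pos])

lemma integrable_vague_test_function:
  fixes S :: "'a::metric_space set"
  assumes \<mu>: "\<mu> \<in> locally_finite_measures S" and f: "f \<in> vague_test_functions S"
  shows "integrable \<mu> f"
proof -
  note [measurable_cong] = locally_finite_measuresD(2)[OF \<mu>]
  obtain K where cont: "continuous_on S f" and K: "compact K" "K \<subseteq> S" "\<And>x. x \<in> S - K \<Longrightarrow> f x = 0"
    using f by (auto simp: vague_test_functions_def)
  have "compact (f ` K)" using K cont by (meson compact_continuous_image continuous_on_subset)
  then obtain C where C: "\<And>x. x \<in> K \<Longrightarrow> \<bar>f x\<bar> \<le> C"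
    using compact_imp_bounded by (metis bounded_real imageI)
  have Kb: "K \<in> relcompact_borel S"
    using K unfolding relcompact_borel_def
    by (auto simp: sets_restrict_space intro!: image_eqI[where x=K] borel_compact)
  then have fin: "emeasure \<mu> K < \<infinity>" using locally_finite_measuresD(3)[OF \<mu>] by blast
  have Kset: "K \<in> sets \<mu>" using Kb locally_finite_measuresD(2)[OF \<mu>] relcompact_borelD by blast
  have meas: "f \<in> borel_measurable \<mu>"
    using borel_measurable_continuous_on_restrict[OF cont] measurable_cong_sets[OF locally_finite_measuresD(2)[OF \<mu>] refl]
    by blast
  have "integrable \<mu> (\<lambda>x. indicator K x * C)"
    using fin Kset by simp
  then show ?thesis
  proof (rule Bochner_Integration.integrable_bound)
    show "AE x in \<mu>. norm (f x) \<le> norm (indicator K x * C)"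
      using K C locally_finite_measuresD(1)[OF \<mu>]
      by (intro AE_I2) (auto simp: indicator_def split: if_splits intro: order_trans[OF C])
  qed (rule meas)
qed

text \<open>
  A test function is uniformly continuous on a window containing its support, hence close to the
  step function that takes on each cell the value at the right end point. The window \<open>m0\<close>
  depends only on the support and not on \<open>e\<close>; this order of quantifiers is what makes the error
  \<open>e * \<mu> window\<close> small for a given measure.
\<close>

lemma vague_test_function_grid_approx:
  assumes f: "f \<in> vague_test_functions {0<..}"
  shows "\<exists>m0. \<forall>e>0. \<exists>m1\<ge>m0. \<forall>m\<ge>m1. \<forall>\<mu>\<in>locally_finite_measures {0<..}.
    \<bar>(\<integral>x. f x \<partial>\<mu>) - (\<Sum>j=0..<grid_size m. f (grid_point m (Suc j)) * measure \<mu> (grid_cell m j))\<bar>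
      \<le> e * measure \<mu> {exp (- real m0) <.. exp (real m0)}"
proof -
  let ?S = "{0<..} :: real set"
  obtain K where cont: "continuous_on ?S f" and K: "compact K" "K \<subseteq> ?S"
      "\<And>x. x \<in> ?S - K \<Longrightarrow> f x = 0"
    using f by (auto simp: vague_test_functions_def)
  obtain m0 where m0: "K \<subseteq> {exp (- real m0) <.. exp (real m0)}"
  proof -
    have "compact (ln ` K)"
      using K by (intro compact_continuous_image continuous_on_ln) auto
    then obtain B where B: "\<And>x. x \<in> K \<Longrightarrow> \<bar>ln x\<bar> \<le> B"
      using compact_imp_bounded by (metis bounded_real imageI)
    obtain m0 :: nat where "B < real m0" using reals_Archimedean2 by blast
    have "x \<in> {exp (- real m0) <.. exp (real m0)}" if "x \<in> K" for x
    proof -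
      have "- real m0 < ln x" "ln x \<le> real m0" using B[OF that] \<open>B < real m0\<close> by linarith+
      then have "exp (- real m0) < exp (ln x)" "exp (ln x) \<le> exp (real m0)" by simp_all
      moreover have "exp (ln x) = x" using K(2) that by auto
      ultimately show ?thesis by (metis greaterThanAtMost_iff)
    qed
    then show thesis by (intro that) blast
  qed
  define W where "W = {exp (- real m0) <.. exp (real m0)}"
  show ?thesis
  proof (rule exI[of _ m0], intro allI impI)
    fix e :: real assume e: "0 < e"
    have "uniformly_continuous_on {exp (- real m0) .. exp (real m0)} f"
      by (intro compact_uniformly_continuous continuous_on_subset[OF cont]) (auto intro: less_le_trans[OF exp_gt_zero])
    then obtain d where d: "0 < d" and d': "\<forall>x\<in>{exp (- real m0) .. exp (real m0)}. \<forall>y\<in>{exp (- real m0) .. exp (real m0)}.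
        dist y x < d \<longrightarrow> dist (f y) (f x) < e"
      using e unfolding uniformly_continuous_on_def by blast
    have d_W: "\<bar>f x - f y\<bar> < e" if "x \<in> W" "y \<in> W" "\<bar>x - y\<bar> < d" for x y
      using d'[rule_format, of y x] that by (auto simp: W_def dist_real_def)
    \<comment> \<open>From level \<open>m1\<close> on, the cells inside the window are shorter than \<open>d\<close>.\<close>
    obtain m1 where m1: "exp (real m0) / d < 2 ^ m1"
      using real_arch_pow[of 2 "exp (real m0) / d"] by auto
    show "\<exists>m1\<ge>m0. \<forall>m\<ge>m1. \<forall>\<mu>\<in>locally_finite_measures {0<..}.
      \<bar>(\<integral>x. f x \<partial>\<mu>) - (\<Sum>j=0..<grid_size m. f (grid_point m (Suc j)) * measure \<mu> (grid_cell m j))\<bar>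
        \<le> e * measure \<mu> {exp (- real m0) <.. exp (real m0)}"
    proof (intro exI[of _ "max m0 m1"] conjI allI impI ballI)
      fix m \<mu> assume m: "max m0 m1 \<le> m" and \<mu>: "\<mu> \<in> locally_finite_measures ?S"
      note sets_\<mu> = locally_finite_measuresD(2)[OF \<mu>]
      have cell_sets: "grid_cell m j \<in> sets \<mu>" for j
        using relcompact_borelD[OF relcompact_grid_cell] sets_\<mu> by simp
      have cell_fin: "emeasure \<mu> (grid_cell m j) < \<infinity>" for j
        by (rule locally_finite_measuresD(3)[OF \<mu> relcompact_grid_cell])
      have "W \<in> relcompact_borel ?S" unfolding W_def by (rule relcompact_interval) simp
      then have W_sets: "W \<in> sets \<mu>" and W_fin: "emeasure \<mu> W < \<infinity>"
        using relcompact_borelD sets_\<mu> locally_finite_measuresD(3)[OF \<mu>] by blast+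
      define s where
        "s x = (\<Sum>j=0..<grid_size m. f (grid_point m (Suc j)) * indicator (grid_cell m j) x)" for x
      define p q where "p = (m - m0) * 2 ^ m" and "q = (m + m0) * 2 ^ m"
      have pq: "p \<le> q" "q \<le> grid_size m" "grid_point m p = exp (- real m0)" "grid_point m q = exp (real m0)"
        using grid_window[of m0 m] m by (auto simp: p_def q_def)
      have W_cells: "W = (\<Union>j\<in>{p..<q}. grid_cell m j)"
        using Union_grid_cell[OF pq(1), of m] pq by (simp add: W_def)
      \<comment> \<open>The window ends at grid points, so the right end point of a cell lies in it only with the whole cell.\<close>
      have outside: "f (grid_point m (Suc j)) = 0" if "j \<notin> {p..<q}" for j
      proof -
        have "grid_point m (Suc j) \<notin> W"
        proof (cases "j < p")
          case True
          then show ?thesis using grid_point_mono[of "Suc j" p m] pq by (auto simp: W_def)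
        next
          case False
          then have "q \<le> j" using that by auto
          then show ?thesis
            using grid_point_mono[of q j m] grid_point_less_Suc[of m j] pq by (auto simp: W_def)
        qed
        then have "grid_point m (Suc j) \<notin> K" using m0 unfolding W_def by blast
        then show ?thesis using K(3) grid_point_pos[of m "Suc j"] by simp
      qed
      have pointwise: "\<bar>f x - s x\<bar> \<le> e * indicator W x" if "x \<in> ?S" for x
      proof (cases "x \<in> W")
        case True
        then obtain j where j: "p \<le> j" "j < q" "x \<in> grid_cell m j" using W_cells by auto
        have "s x = (\<Sum>i=0..<grid_size m. if i = j then f (grid_point m (Suc j)) else 0)"
          unfolding s_def using j disjoint_family_grid_cell[of m]
          by (intro sum.cong) (auto simp: disjoint_family_on_def indicator_def)
        also have "\<dots> = f (grid_point m (Suc j))" using j pq by simp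
        finally have sx: "s x = f (grid_point m (Suc j))" .
        have "grid_point m (Suc j) \<in> grid_cell m j"
          by (simp add: grid_cell_def grid_point_less_Suc)
        then have pW: "grid_point m (Suc j) \<in> W" using W_cells j by auto
        have "\<bar>x - grid_point m (Suc j)\<bar> \<le> grid_point m (Suc j) - grid_point m j"
          using j by (auto simp: grid_cell_def)
        also have "\<dots> \<le> grid_point m (Suc j) / 2 ^ m" by (rule grid_cell_length)
        also have "\<dots> \<le> exp (real m0) / 2 ^ m" using pW by (simp add: W_def divide_right_mono)
        also have "\<dots> < d"
        proof -
          have "exp (real m0) / d < 2 ^ m"
            using m1 m by (meson less_le_trans max.bounded_iff one_le_numeral power_increasing)
          then show ?thesis using d by (simp add: field_simps)
        qed
        finally show ?thesis using d_W[OF True pW] sx True by simp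
      next
        case False
        then have "x \<notin> K" using m0 unfolding W_def by blast
        then have "f x = 0" using K(3)[of x] that by simp
        moreover have "s x = 0"
          unfolding s_def
        proof (intro sum.neutral ballI)
          fix j
          show "f (grid_point m (Suc j)) * indicator (grid_cell m j) x = 0"
            using outside[of j] W_cells False by (cases "j \<in> {p..<q}") (auto simp: indicator_def)
        qed
        ultimately show ?thesis using False by simp
      qed
      have int_s: "integrable \<mu> s"
        unfolding s_def using cell_sets cell_fin
        by (intro Bochner_Integration.integrable_sum integrable_mult_right integrable_real_indicator) auto
      have int_f: "integrable \<mu> f" by (rule integrable_vague_test_function[OF \<mu> f])
      have s_eq: "(\<integral>x. s x \<partial>\<mu>) = (\<Sum>j=0..<grid_size m. f (grid_point m (Suc j)) * measure \<mu> (grid_cell m j))"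
        unfolding s_def using cell_sets cell_fin
        by (subst Bochner_Integration.integral_sum) 
          (auto intro!: sum.cong integrable_mult_right integrable_real_indicator simp: sets.Int_space_eq2)
      have "\<bar>(\<integral>x. f x \<partial>\<mu>) - (\<integral>x. s x \<partial>\<mu>)\<bar> = \<bar>\<integral>x. f x - s x \<partial>\<mu>\<bar>"
        using int_f int_s by simp
      also have "\<dots> \<le> (\<integral>x. e * indicator W x \<partial>\<mu>)"
        using int_f int_s W_sets W_fin locally_finite_measuresD(1)[OF \<mu>]
        by (intro order_trans[OF integral_abs_bound] integral_mono pointwise) auto
      also have "\<dots> = e * measure \<mu> W"
        using W_sets by (simp add: sets.Int_space_eq2)
      finally show "\<bar>(\<integral>x. f x \<partial>\<mu>) - (\<Sum>j=0..<grid_size m. f (grid_point m (Suc j)) * measure \<mu> (grid_cell m j))\<bar>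
        \<le> e * measure \<mu> {exp (- real m0) <.. exp (real m0)}"
        by (simp add: s_eq W_def)
    qed simp
  qed
qed

lemma measure_window_grid:
  assumes \<mu>: "\<mu> \<in> locally_finite_measures {0<..}" and "m0 \<le> m"
  shows "measure \<mu> {exp (- real m0) <.. exp (real m0)} =
    (\<Sum>j\<in>{(m - m0) * 2 ^ m..<(m + m0) * 2 ^ m}. measure \<mu> (grid_cell m j))"
proof -
  have le: "(m - m0) * 2 ^ m \<le> (m + m0) * 2 ^ m" by simp
  have cell_sets: "grid_cell m j \<in> sets \<mu>" for j
    using relcompact_borelD[OF relcompact_grid_cell] locally_finite_measuresD(2)[OF \<mu>] by simp
  have cell_fin: "emeasure \<mu> (grid_cell m j) \<noteq> \<infinity>" for j
    using locally_finite_measuresD(3)[OF \<mu> relcompact_grid_cell[of m j]] by simp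
  show ?thesis
    using Union_grid_cell[OF le, of m] grid_window(1,2)[OF assms(2)] cell_sets cell_fin disjoint_family_grid_cell[of m]
    by (subst measure_finite_Union[symmetric]) (auto simp: disjoint_family_on_def)
qed

text \<open>
  Both integrals are within \<open>e\<close> times the mass of a fixed window of the same step-function sum,
  and the two measures give that window the same mass, because it is a union of cells.
\<close>

lemma vague_test_function_integral_LIMSEQ:
  assumes f: "f \<in> vague_test_functions {0<..}"
    and \<mu>: "\<mu> \<in> locally_finite_measures {0<..}" and \<nu>: "\<And>m. \<nu> m \<in> locally_finite_measures {0<..}"
    and eq: "\<And>m j. j < grid_size m \<Longrightarrow> measure (\<nu> m) (grid_cell m j) = measure \<mu> (grid_cell m j)"
  shows "(\<lambda>m. \<integral>x. f x \<partial>\<nu> m) \<longlonglongrightarrow> (\<integral>x. f x \<partial>\<mu>)"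
proof (rule LIMSEQ_I)
  fix r :: real assume r: "0 < r"
  obtain m0 where approx: "\<forall>e>0. \<exists>m1\<ge>m0. \<forall>m\<ge>m1. \<forall>\<mu>\<in>locally_finite_measures {0<..}.
      \<bar>(\<integral>x. f x \<partial>\<mu>) - (\<Sum>j=0..<grid_size m. f (grid_point m (Suc j)) * measure \<mu> (grid_cell m j))\<bar>
        \<le> e * measure \<mu> {exp (- real m0) <.. exp (real m0)}"
    using vague_test_function_grid_approx[OF f] by (elim exE)
  let ?W = "{exp (- real m0) <.. exp (real m0)}"
  define e where "e = r / (3 * (measure \<mu> ?W + 1))"
  have W1: "0 < measure \<mu> ?W + 1" by (simp add: add_nonneg_pos)
  then have e: "0 < e" using r by (simp add: e_def)
  have small: "2 * (e * measure \<mu> ?W) < r"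
  proof -
    have "2 * (e * measure \<mu> ?W) \<le> 2 * (e * (measure \<mu> ?W + 1))" using e by simp
    also have "\<dots> = 2 * r / 3" using W1 by (simp add: e_def field_simps)
    finally show ?thesis using r by linarith
  qed
  obtain m1 where "m0 \<le> m1" and m1: "\<And>m \<mu>. m1 \<le> m \<Longrightarrow> \<mu> \<in> locally_finite_measures {0<..} \<Longrightarrow>
      \<bar>(\<integral>x. f x \<partial>\<mu>) - (\<Sum>j=0..<grid_size m. f (grid_point m (Suc j)) * measure \<mu> (grid_cell m j))\<bar>
        \<le> e * measure \<mu> ?W"
    using approx[rule_format, OF e] by (elim exE conjE) (simp add: Ball_def)
  show "\<exists>no. \<forall>m\<ge>no. norm ((\<integral>x. f x \<partial>\<nu> m) - (\<integral>x. f x \<partial>\<mu>)) < r"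
  proof (intro exI[of _ m1] allI impI)
    fix m assume m: "m1 \<le> m"
    have "measure (\<nu> m) ?W = measure \<mu> ?W"
    proof -
      have "m0 \<le> m" using m \<open>m0 \<le> m1\<close> by simp
      from grid_window(3)[OF this] show ?thesis
        unfolding measure_window_grid[OF \<mu> \<open>m0 \<le> m\<close>] measure_window_grid[OF \<nu> \<open>m0 \<le> m\<close>]
        by (intro sum.cong refl eq) auto
    qed
    note W_eq = this
    have sum_eq: "(\<Sum>j=0..<grid_size m. f (grid_point m (Suc j)) * measure (\<nu> m) (grid_cell m j)) =
        (\<Sum>j=0..<grid_size m. f (grid_point m (Suc j)) * measure \<mu> (grid_cell m j))"
      by (intro sum.cong) (auto simp: eq)
    show "norm ((\<integral>x. f x \<partial>\<nu> m) - (\<integral>x. f x \<partial>\<mu>)) < r"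
      using m1[OF m \<mu>] m1[OF m \<nu>[of m], unfolded W_eq sum_eq] small by (auto simp: abs_if split: if_splits)
  qed
qed

lemma topspace_vague_topology: "topspace (vague_topology S) = locally_finite_measures S"
proof -
  have "(\<lambda>_. 0) \<in> vague_test_functions S"
    by (auto simp: vague_test_functions_def intro!: exI[of _ "{}"])
  then show ?thesis unfolding vague_topology_def topology_generated_by_topspace by blast
qed

text \<open>
  Convergence of the integrals of all test functions is convergence in the topology that they
  generate; it suffices to check the subbasis.
\<close>

lemma vague_topology_LIMSEQ:
  assumes g: "continuous_map (vague_topology S) euclideanreal g"
    and \<mu>: "\<mu> \<in> locally_finite_measures S" and \<nu>: "\<And>m::nat. \<nu> m \<in> locally_finite_measures S"
    and lim: "\<And>f. f \<in> vague_test_functions S \<Longrightarrow> (\<lambda>m. \<integral>x. f x \<partial>\<nu> m) \<longlonglongrightarrow> (\<integral>x. f x \<partial>\<mu>)"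
  shows "(\<lambda>m. g (\<nu> m)) \<longlonglongrightarrow> g \<mu>"
proof -
  have "eventually (\<lambda>m. \<nu> m \<in> U) sequentially" if "openin (vague_topology S) U" "\<mu> \<in> U" for U
    using openin_topology_generated_by[OF that(1)[unfolded vague_topology_def]] that(2)
  proof induction
    case (Int a b)
    then show ?case by (auto intro: eventually_conj)
  next
    case (UN K)
    then obtain k where "k \<in> K" "eventually (\<lambda>m. \<nu> m \<in> k) sequentially" by blast
    then show ?case by (auto elim: eventually_mono)
  next
    case (Basis s)
    then obtain f U where s: "s = {\<mu> \<in> locally_finite_measures S. (\<integral>x. f x \<partial>\<mu>) \<in> U}"
      "f \<in> vague_test_functions S" "open U" by auto
    then have "eventually (\<lambda>m. (\<integral>x. f x \<partial>\<nu> m) \<in> U) sequentially"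
      using Basis lim[OF s(2)] by (intro topological_tendstoD) auto
    then show ?case using \<nu> s by auto
  qed simp
  then have "limitin (vague_topology S) \<nu> \<mu> sequentially"
    using \<mu> by (auto simp: limitin_def topspace_vague_topology)
  from continuous_map_limit[OF g this] show ?thesis by (simp add: o_def)
qed

lemma point_processD:
  assumes "point_process M S \<xi>"
  shows "prob_space M" "\<omega> \<in> space M \<Longrightarrow> \<xi> \<omega> \<in> locally_finite_counting_measures S"
    "B \<in> sets (restrict_space borel S) \<Longrightarrow> (\<lambda>\<omega>. emeasure (\<xi> \<omega>) B) \<in> borel_measurable M"
  using assms by (auto simp: point_process_def)

lemma counting_measure_of_nat:
  assumes "\<mu> \<in> locally_finite_counting_measures S" "B \<in> relcompact_borel S"
  obtains k :: nat where "emeasure \<mu> B = of_nat k" "measure \<mu> B = real k"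
proof -
  obtain k :: nat where "emeasure \<mu> B = of_nat k"
    using assms by (auto simp: locally_finite_counting_measures_def)
  then show thesis using that[of k] by (simp add: measure_def)
qed

lemma measure_grid_cell_eq_nth:
  assumes "\<mu> \<in> locally_finite_counting_measures {0<..}" "j < grid_size m"
  shows "measure \<mu> (grid_cell m j) = real (grid_counts m \<mu> ! j)"
  using assms(2) by (rule_tac counting_measure_of_nat[OF assms(1) relcompact_grid_cell[of m j]])
    (simp add: grid_counts_def)

lemma length_grid_counts [simp]: "length (grid_counts m \<mu>) = grid_size m"
  by (simp add: grid_counts_def)

text \<open>
  The infimum of \<open>g\<close> over all counting measures with the grid counts \<open>l\<close>. The value \<open>0\<close> for count
  vectors that no measure realises keeps it within the bounds of \<open>g\<close>.
\<close>

definition grid_lower :: "(real measure \<Rightarrow> real) \<Rightarrow> nat \<Rightarrow> nat list \<Rightarrow> real" where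
  "grid_lower g m l = (let A = {\<nu> \<in> locally_finite_counting_measures {0<..}. grid_counts m \<nu> = l}
     in if A = {} then 0 else Inf (g ` A))"

lemma grid_lower_bounds:
  assumes "\<And>\<nu>. \<nu> \<in> locally_finite_measures {0<..} \<Longrightarrow> 0 \<le> g \<nu> \<and> g \<nu> \<le> C" "0 \<le> C"
  shows "0 \<le> grid_lower g m l" "grid_lower g m l \<le> C"
    and "\<mu> \<in> locally_finite_counting_measures {0<..} \<Longrightarrow> grid_lower g m (grid_counts m \<mu>) \<le> g \<mu>"
proof -
  have bdd: "bdd_below (g ` {\<nu> \<in> locally_finite_counting_measures {0<..}. grid_counts m \<nu> = l})" for l
    using assms(1)[OF counting_imp_locally_finite] by (intro bdd_belowI[of _ 0]) auto
  show low: "grid_lower g m (grid_counts m \<mu>) \<le> g \<mu>"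
    if "\<mu> \<in> locally_finite_counting_measures {0<..}" for \<mu>
    using that bdd by (auto simp: grid_lower_def Let_def intro!: cInf_lower)
  show "0 \<le> grid_lower g m l"
    using assms(1)[OF counting_imp_locally_finite] by (auto simp: grid_lower_def Let_def intro!: cInf_greatest)
  show "grid_lower g m l \<le> C"
  proof (cases "\<exists>\<nu>\<in>locally_finite_counting_measures {0<..}. grid_counts m \<nu> = l")
    case True
    then obtain \<nu> where "\<nu> \<in> locally_finite_counting_measures {0<..}" "grid_counts m \<nu> = l" by blast
    then show ?thesis using low[of \<nu>] assms(1)[OF counting_imp_locally_finite[of \<nu>]] by auto
  next
    case False
    then show ?thesis using assms(2) by (auto simp: grid_lower_def Let_def)
  qed
qed

text \<open>
  Choose at every level a measure in the cell class of \<open>\<mu>\<close> at which \<open>g\<close> nearly attains its infimum.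
  These measures share all grid counts with \<open>\<mu>\<close>, so they converge vaguely to \<open>\<mu>\<close>, and continuity
  of \<open>g\<close> closes the gap.
\<close>

lemma grid_lower_LIMSEQ:
  assumes g: "continuous_map (vague_topology {0<..}) euclideanreal g"
    and bnd: "\<And>\<nu>. \<nu> \<in> locally_finite_measures {0<..} \<Longrightarrow> 0 \<le> g \<nu> \<and> g \<nu> \<le> C" and C: "0 \<le> C"
    and \<mu>: "\<mu> \<in> locally_finite_counting_measures {0<..}"
  shows "(\<lambda>m. grid_lower g m (grid_counts m \<mu>)) \<longlonglongrightarrow> g \<mu>"
proof -
  have "\<exists>\<nu>. \<nu> \<in> locally_finite_counting_measures {0<..} \<and> grid_counts m \<nu> = grid_counts m \<mu> \<and>
      g \<nu> < grid_lower g m (grid_counts m \<mu>) + inverse (real (Suc m))" for m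
  proof -
    let ?A = "{\<nu> \<in> locally_finite_counting_measures {0<..}. grid_counts m \<nu> = grid_counts m \<mu>}"
    have "\<mu> \<in> ?A" using \<mu> by simp
    then have "grid_lower g m (grid_counts m \<mu>) = Inf (g ` ?A)" and "g ` ?A \<noteq> {}"
      by (auto simp: grid_lower_def Let_def)
    then have "\<exists>y\<in>g ` ?A. y < grid_lower g m (grid_counts m \<mu>) + inverse (real (Suc m))"
      by (intro cInf_lessD) auto
    then show ?thesis by auto
  qed
  then obtain \<nu> where \<nu>: "\<And>m. \<nu> m \<in> locally_finite_counting_measures {0<..}"
      "\<And>m. grid_counts m (\<nu> m) = grid_counts m \<mu>"
      "\<And>m. g (\<nu> m) < grid_lower g m (grid_counts m \<mu>) + inverse (real (Suc m))"
    by metis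
  have lim: "(\<lambda>m. g (\<nu> m)) \<longlonglongrightarrow> g \<mu>"
    using \<nu> \<mu>
    by (intro vague_topology_LIMSEQ[OF g] vague_test_function_integral_LIMSEQ)
       (auto simp: measure_grid_cell_eq_nth counting_imp_locally_finite)
  show ?thesis
  proof (rule tendsto_sandwich)
    show "(\<lambda>m. g (\<nu> m) - inverse (real (Suc m))) \<longlonglongrightarrow> g \<mu>"
      using tendsto_diff[OF lim LIMSEQ_inverse_real_of_nat] by simp
    show "\<forall>\<^sub>F m in sequentially. g (\<nu> m) - inverse (real (Suc m)) \<le> grid_lower g m (grid_counts m \<mu>)"
      using \<nu>(3) by (intro always_eventually allI) (simp add: less_imp_le algebra_simps)
    show "\<forall>\<^sub>F m in sequentially. grid_lower g m (grid_counts m \<mu>) \<le> g \<mu>"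
      using grid_lower_bounds(3)[where g=g and C=C, OF bnd C \<mu>] by simp
  qed simp
qed

lemma measurable_map_count_space:
  fixes h :: "'b \<Rightarrow> 'w \<Rightarrow> 'c::countable"
  assumes "\<And>j. j \<in> set js \<Longrightarrow> h j \<in> measurable M (count_space UNIV)"
  shows "(\<lambda>\<omega>. map (\<lambda>j. h j \<omega>) js) \<in> measurable M (count_space UNIV)"
  using assms
proof (induction js)
  case (Cons j js)
  have tail: "(\<lambda>\<omega>. map (\<lambda>j. h j \<omega>) js) \<in> measurable M (count_space UNIV)"
    using Cons by simp
  have "(\<lambda>\<omega>. i # map (\<lambda>j. h j \<omega>) js) \<in> measurable M (count_space UNIV)" for i
    by (rule measurable_compose[OF tail]) simp
  from measurable_compose_countable[OF this, of "h j"]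
  have "(\<lambda>\<omega>. h j \<omega> # map (\<lambda>j. h j \<omega>) js) \<in> measurable M (count_space UNIV)"
    using Cons(2) by simp
  then show ?case by simp
qed simp

lemma measurable_measure_point_process:
  assumes "point_process M S \<xi>" "B \<in> sets (restrict_space borel S)"
  shows "(\<lambda>\<omega>. measure (\<xi> \<omega>) B) \<in> borel_measurable M"
  using point_processD(3)[OF assms] unfolding measure_def by simp

lemma measurable_grid_counts:
  assumes "point_process M {0<..} \<xi>"
  shows "(\<lambda>\<omega>. grid_counts m (\<xi> \<omega>)) \<in> measurable M (count_space UNIV)"
  unfolding grid_counts_def
proof (rule measurable_map_count_space)
  fix j
  have "(\<lambda>\<omega>. measure (\<xi> \<omega>) (grid_cell m j)) \<in> borel_measurable M"
    by (rule measurable_measure_point_process[OF assms relcompact_borelD[OF relcompact_grid_cell]])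
  then show "(\<lambda>\<omega>. nat \<lfloor>measure (\<xi> \<omega>) (grid_cell m j)\<rfloor>) \<in> measurable M (count_space UNIV)"
    by measurable
qed

text \<open>
  A vaguely continuous function of a point process is a random variable: it is a limit of functions
  of the countably-valued grid counts. Without this fact its Bochner integral could be the
  default value \<open>0\<close>.
\<close>

lemma measurable_continuous_point_process:
  fixes g :: "real measure \<Rightarrow> real"
  assumes \<xi>: "point_process M {0<..} \<xi>"
    and g: "continuous_map (vague_topology {0<..}) euclideanreal g"
    and bnd: "\<And>\<nu>. \<nu> \<in> locally_finite_measures {0<..} \<Longrightarrow> 0 \<le> g \<nu> \<and> g \<nu> \<le> C" and C: "0 \<le> C"
  shows "(\<lambda>\<omega>. g (\<xi> \<omega>)) \<in> borel_measurable M"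
proof (rule borel_measurable_LIMSEQ_real)
  fix \<omega> assume "\<omega> \<in> space M"
  then show "(\<lambda>m. grid_lower g m (grid_counts m (\<xi> \<omega>))) \<longlonglongrightarrow> g (\<xi> \<omega>)"
    by (intro grid_lower_LIMSEQ[OF g bnd C] point_processD(2)[OF \<xi>])
next
  fix m
  show "(\<lambda>\<omega>. grid_lower g m (grid_counts m (\<xi> \<omega>))) \<in> borel_measurable M"
    by (rule measurable_compose[OF measurable_grid_counts[OF \<xi>]]) simp
qed

section \<open>A criterion for vague convergence in distribution\<close>

text \<open>
  For non-negative \<open>g\<close> only lower bounds are required. Bound \<open>g\<close> from below by \<open>grid_lower g m\<close> and
  discard all configurations with a cell of two or more points: what remains is a finite sum over
  zero-one count vectors, whose lower limit is controlled by the hypothesis on their probabilities.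
  For the limit process the discarded part is negligible when \<open>m\<close> is large. The hypothesis
  on the minimum says that the lower limit of the probabilities is at least the limit probability,
  in a form that is convenient for sums and products.
\<close>

lemma liminf_expectation_point_process:
  fixes \<xi> :: "nat \<Rightarrow> 'v \<Rightarrow> real measure" and \<eta> :: "'w \<Rightarrow> real measure"
  assumes \<xi>: "\<And>n. point_process (M n) {0<..} (\<xi> n)" and \<eta>: "point_process N {0<..} \<eta>"
    and fdd: "\<And>m l. length l = grid_size m \<Longrightarrow> set l \<subseteq> {0, 1} \<Longrightarrow>
      (\<lambda>n. min (\<P>(\<omega> in M n. grid_counts m (\<xi> n \<omega>) = l)) (\<P>(\<omega> in N. grid_counts m (\<eta> \<omega>) = l)))
        \<longlonglongrightarrow> \<P>(\<omega> in N. grid_counts m (\<eta> \<omega>) = l)"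
    and simple: "(\<lambda>m. \<P>(\<omega> in N. \<not> set (grid_counts m (\<eta> \<omega>)) \<subseteq> {0, 1})) \<longlonglongrightarrow> 0"
    and g: "continuous_map (vague_topology {0<..}) euclideanreal g"
    and bnd: "\<And>\<nu>. \<nu> \<in> locally_finite_measures {0<..} \<Longrightarrow> 0 \<le> g \<nu> \<and> g \<nu> \<le> C" and C: "0 \<le> C"
    and e: "0 < e"
  shows "eventually (\<lambda>n. (\<integral>\<omega>. g (\<eta> \<omega>) \<partial>N) - e < (\<integral>\<omega>. g (\<xi> n \<omega>) \<partial>M n)) sequentially"
proof -
  interpret N: prob_space N by (rule point_processD(1)[OF \<eta>])
  note meas_\<eta> [measurable] = measurable_grid_counts[OF \<eta>]
  note h_bnd = grid_lower_bounds[where g=g and C=C, OF bnd C]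
  have "(\<lambda>m. \<integral>\<omega>. grid_lower g m (grid_counts m (\<eta> \<omega>)) \<partial>N) \<longlonglongrightarrow> (\<integral>\<omega>. g (\<eta> \<omega>) \<partial>N)"
    using h_bnd
    by (intro integral_dominated_convergence[where w="\<lambda>_. C"] AE_I2
        grid_lower_LIMSEQ[OF g bnd C] point_processD(2)[OF \<eta>] measurable_continuous_point_process[OF \<eta> g bnd C]
        measurable_compose[OF meas_\<eta>]) auto
  then have "(\<lambda>m. (\<integral>\<omega>. grid_lower g m (grid_counts m (\<eta> \<omega>)) \<partial>N) -
      C * \<P>(\<omega> in N. \<not> set (grid_counts m (\<eta> \<omega>)) \<subseteq> {0, 1})) \<longlonglongrightarrow> (\<integral>\<omega>. g (\<eta> \<omega>) \<partial>N) - C * 0"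
    using simple by (intro tendsto_intros)
  then have "eventually (\<lambda>m. (\<integral>\<omega>. g (\<eta> \<omega>) \<partial>N) - e < (\<integral>\<omega>. grid_lower g m (grid_counts m (\<eta> \<omega>)) \<partial>N) -
      C * \<P>(\<omega> in N. \<not> set (grid_counts m (\<eta> \<omega>)) \<subseteq> {0, 1})) sequentially"
    using e by (intro order_tendstoD) auto
  \<comment> \<open>A level at which the lower envelope and the discarded configurations together cost less than \<open>e\<close>.\<close>
  then obtain m where m: "(\<integral>\<omega>. g (\<eta> \<omega>) \<partial>N) - e < (\<integral>\<omega>. grid_lower g m (grid_counts m (\<eta> \<omega>)) \<partial>N) -
      C * \<P>(\<omega> in N. \<not> set (grid_counts m (\<eta> \<omega>)) \<subseteq> {0, 1})"
    using eventually_happens by fastforce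
  define h where "h = grid_lower g m"
  define L where "L = {l. set l \<subseteq> {0, 1::nat} \<and> length l = grid_size m}"
  have finL: "finite L" unfolding L_def by (rule finite_lists_length_eq) simp
  let ?p = "\<lambda>l. \<P>(\<omega> in N. grid_counts m (\<eta> \<omega>) = l)"
  let ?D = "{\<omega> \<in> space N. \<not> set (grid_counts m (\<eta> \<omega>)) \<subseteq> {0, 1}}"
  have "(\<lambda>\<omega>. grid_counts m (\<eta> \<omega>)) -` {l. \<not> set l \<subseteq> {0, 1}} \<inter> space N \<in> sets N"
    by (rule measurable_sets[OF meas_\<eta>]) simp
  also have "(\<lambda>\<omega>. grid_counts m (\<eta> \<omega>)) -` {l. \<not> set l \<subseteq> {0, 1}} \<inter> space N = ?D" by auto
  finally have D_sets: "?D \<in> sets N" .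
  have h01: "0 \<le> h l" "h l \<le> C" for l using h_bnd(1,2) by (auto simp: h_def)
  have "(\<integral>\<omega>. h (grid_counts m (\<eta> \<omega>)) \<partial>N) \<le>
      (\<integral>\<omega>. (\<Sum>l\<in>L. h l * indicator {\<omega> \<in> space N. grid_counts m (\<eta> \<omega>) = l} \<omega>) + C * indicator ?D \<omega> \<partial>N)"
  proof (rule integral_mono)
    show "integrable N (\<lambda>\<omega>. h (grid_counts m (\<eta> \<omega>)))"
      using h01 by (intro N.integrable_const_bound[where B=C] measurable_compose[OF meas_\<eta>]) auto
    show "integrable N (\<lambda>\<omega>. (\<Sum>l\<in>L. h l * indicator {\<omega> \<in> space N. grid_counts m (\<eta> \<omega>) = l} \<omega>) + C * indicator ?D \<omega>)"
      using D_sets by (intro Bochner_Integration.integrable_add Bochner_Integration.integrable_sum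
          integrable_mult_right integrable_real_indicator) (auto simp: N.emeasure_eq_measure)
  next
    fix \<omega> assume \<omega>: "\<omega> \<in> space N"
    have "(\<Sum>l\<in>L. h l * indicator {\<omega> \<in> space N. grid_counts m (\<eta> \<omega>) = l} \<omega>) =
        (\<Sum>l\<in>L. if l = grid_counts m (\<eta> \<omega>) then h l else 0)"
      using \<omega> by (intro sum.cong) auto
    also have "\<dots> = (if grid_counts m (\<eta> \<omega>) \<in> L then h (grid_counts m (\<eta> \<omega>)) else 0)"
      using finL by simp
    finally show "h (grid_counts m (\<eta> \<omega>)) \<le>
        (\<Sum>l\<in>L. h l * indicator {\<omega> \<in> space N. grid_counts m (\<eta> \<omega>) = l} \<omega>) + C * indicator ?D \<omega>"
      using h01 C \<omega> by (auto simp: L_def)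
  qed
  also have "\<dots> = (\<Sum>l\<in>L. h l * ?p l) + C * N.prob ?D"
    using D_sets
    by (subst Bochner_Integration.integral_add)
       (auto simp: Bochner_Integration.integral_sum N.emeasure_eq_measure intro!: Bochner_Integration.integrable_sum)
  finally have "(\<integral>\<omega>. g (\<eta> \<omega>) \<partial>N) - e < (\<Sum>l\<in>L. h l * ?p l)"
    using m by (simp add: h_def)
  moreover have "(\<lambda>n. \<Sum>l\<in>L. h l * min (\<P>(\<omega> in M n. grid_counts m (\<xi> n \<omega>) = l)) (?p l))
      \<longlonglongrightarrow> (\<Sum>l\<in>L. h l * ?p l)"
    by (intro tendsto_sum tendsto_mult tendsto_const fdd) (auto simp: L_def)
  ultimately have "eventually (\<lambda>n. (\<integral>\<omega>. g (\<eta> \<omega>) \<partial>N) - e <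
      (\<Sum>l\<in>L. h l * min (\<P>(\<omega> in M n. grid_counts m (\<xi> n \<omega>) = l)) (?p l))) sequentially"
    by (intro order_tendstoD)
  then show ?thesis
  proof (rule eventually_mono)
    fix n assume less: "(\<integral>\<omega>. g (\<eta> \<omega>) \<partial>N) - e <
      (\<Sum>l\<in>L. h l * min (\<P>(\<omega> in M n. grid_counts m (\<xi> n \<omega>) = l)) (?p l))"
    interpret Mn: prob_space "M n" by (rule point_processD(1)[OF \<xi>])
    note [measurable] = measurable_grid_counts[OF \<xi>[of n]]
    have "(\<Sum>l\<in>L. h l * min (\<P>(\<omega> in M n. grid_counts m (\<xi> n \<omega>) = l)) (?p l)) \<le>
        (\<Sum>l\<in>L. h l * \<P>(\<omega> in M n. grid_counts m (\<xi> n \<omega>) = l))"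
      using h01 by (intro sum_mono mult_left_mono) auto
    also have "\<dots> = (\<integral>\<omega>. (\<Sum>l\<in>L. h l * indicator {\<omega> \<in> space (M n). grid_counts m (\<xi> n \<omega>) = l} \<omega>) \<partial>M n)"
      by (subst Bochner_Integration.integral_sum) (auto simp: Mn.emeasure_eq_measure)
    also have "\<dots> \<le> (\<integral>\<omega>. g (\<xi> n \<omega>) \<partial>M n)"
    proof (rule integral_mono)
      show "integrable (M n) (\<lambda>\<omega>. \<Sum>l\<in>L. h l * indicator {\<omega> \<in> space (M n). grid_counts m (\<xi> n \<omega>) = l} \<omega>)"
        by (intro Bochner_Integration.integrable_sum integrable_mult_right integrable_real_indicator)
          (auto simp: Mn.emeasure_eq_measure)
      show "integrable (M n) (\<lambda>\<omega>. g (\<xi> n \<omega>))"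
        using bnd[OF counting_imp_locally_finite[OF point_processD(2)[OF \<xi>]]]
        by (intro Mn.integrable_const_bound[where B=C] measurable_continuous_point_process[OF \<xi> g bnd C]) auto
    next
      fix \<omega> assume \<omega>: "\<omega> \<in> space (M n)"
      have "(\<Sum>l\<in>L. h l * indicator {\<omega> \<in> space (M n). grid_counts m (\<xi> n \<omega>) = l} \<omega>) =
          (\<Sum>l\<in>L. if l = grid_counts m (\<xi> n \<omega>) then h l else 0)"
        using \<omega> by (intro sum.cong) auto
      also have "\<dots> \<le> h (grid_counts m (\<xi> n \<omega>))"
        using finL h01 by simp
      also have "\<dots> \<le> g (\<xi> n \<omega>)"
        unfolding h_def by (intro h_bnd(3) point_processD(2)[OF \<xi>] \<omega>)
      finally show "(\<Sum>l\<in>L. h l * indicator {\<omega> \<in> space (M n). grid_counts m (\<xi> n \<omega>) = l} \<omega>) \<le> g (\<xi> n \<omega>)" .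
    qed
    finally show "(\<integral>\<omega>. g (\<eta> \<omega>) \<partial>N) - e < (\<integral>\<omega>. g (\<xi> n \<omega>) \<partial>M n)" using less by simp
  qed
qed

text \<open>
  The one-sided estimate, applied to the non-negative functions \<open>\<bar>B\<bar> + g\<close> and \<open>\<bar>B\<bar> - g\<close>, gives both
  halves of the convergence.
\<close>

lemma converges_vaguely_if_grid_counts:
  fixes \<xi> :: "nat \<Rightarrow> 'v \<Rightarrow> real measure" and \<eta> :: "'w \<Rightarrow> real measure"
  assumes \<xi>: "\<And>n. point_process (M n) {0<..} (\<xi> n)" and \<eta>: "point_process N {0<..} \<eta>"
    and fdd: "\<And>m l. length l = grid_size m \<Longrightarrow> set l \<subseteq> {0, 1} \<Longrightarrow>
      (\<lambda>n. min (\<P>(\<omega> in M n. grid_counts m (\<xi> n \<omega>) = l)) (\<P>(\<omega> in N. grid_counts m (\<eta> \<omega>) = l)))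
        \<longlonglongrightarrow> \<P>(\<omega> in N. grid_counts m (\<eta> \<omega>) = l)"
    and simple: "(\<lambda>m. \<P>(\<omega> in N. \<not> set (grid_counts m (\<eta> \<omega>)) \<subseteq> {0, 1})) \<longlonglongrightarrow> 0"
  shows "converges_vaguely_in_distribution {0<..} M \<xi> N \<eta>"
  unfolding converges_vaguely_in_distribution_def
proof (intro allI impI, elim conjE)
  fix g :: "real measure \<Rightarrow> real"
  assume g: "continuous_map (vague_topology {0<..}) euclideanreal g"
    and "bounded (g ` locally_finite_measures {0<..})"
  then obtain B where "\<And>\<nu>. \<nu> \<in> locally_finite_measures {0<..} \<Longrightarrow> \<bar>g \<nu>\<bar> \<le> B"
    unfolding bounded_real by (metis imageI)
  then have B: "\<bar>g \<nu>\<bar> \<le> \<bar>B\<bar>" if "\<nu> \<in> locally_finite_measures {0<..}" for \<nu>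
    using that by (meson abs_ge_self order_trans)
  have gp: "continuous_map (vague_topology {0<..}) euclideanreal (\<lambda>\<nu>. \<bar>B\<bar> + g \<nu>)"
    and gm: "continuous_map (vague_topology {0<..}) euclideanreal (\<lambda>\<nu>. \<bar>B\<bar> - g \<nu>)"
    using g by (auto intro!: continuous_intros)
  have bp: "0 \<le> \<bar>B\<bar> + g \<nu> \<and> \<bar>B\<bar> + g \<nu> \<le> 2 * \<bar>B\<bar>"
    and bm: "0 \<le> \<bar>B\<bar> - g \<nu> \<and> \<bar>B\<bar> - g \<nu> \<le> 2 * \<bar>B\<bar>"
    if "\<nu> \<in> locally_finite_measures {0<..}" for \<nu>
    using B[OF that] by linarith+
  have C: "0 \<le> 2 * \<bar>B\<bar>" by simp
  have expect: "(\<integral>\<omega>. \<bar>B\<bar> + g (\<zeta> \<omega>) \<partial>Q) = \<bar>B\<bar> + (\<integral>\<omega>. g (\<zeta> \<omega>) \<partial>Q)"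
    "(\<integral>\<omega>. \<bar>B\<bar> - g (\<zeta> \<omega>) \<partial>Q) = \<bar>B\<bar> - (\<integral>\<omega>. g (\<zeta> \<omega>) \<partial>Q)"
    if \<zeta>: "point_process Q {0<..} \<zeta>" for \<zeta> and Q :: "'u measure"
  proof -
    interpret Q: prob_space Q by (rule point_processD(1)[OF \<zeta>])
    have "(\<lambda>\<omega>. (\<bar>B\<bar> + g (\<zeta> \<omega>)) - \<bar>B\<bar>) \<in> borel_measurable Q"
      by (intro borel_measurable_diff measurable_continuous_point_process[OF \<zeta> gp bp C]) auto
    then have "integrable Q (\<lambda>\<omega>. g (\<zeta> \<omega>))"
      using B[OF counting_imp_locally_finite[OF point_processD(2)[OF \<zeta>]]]
      by (intro Q.integrable_const_bound[where B="\<bar>B\<bar>"]) auto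
    then show "(\<integral>\<omega>. \<bar>B\<bar> + g (\<zeta> \<omega>) \<partial>Q) = \<bar>B\<bar> + (\<integral>\<omega>. g (\<zeta> \<omega>) \<partial>Q)"
      "(\<integral>\<omega>. \<bar>B\<bar> - g (\<zeta> \<omega>) \<partial>Q) = \<bar>B\<bar> - (\<integral>\<omega>. g (\<zeta> \<omega>) \<partial>Q)"
      by (simp_all add: Q.prob_space)
  qed
  show "(\<lambda>n. \<integral>\<omega>. g (\<xi> n \<omega>) \<partial>M n) \<longlonglongrightarrow> (\<integral>\<omega>. g (\<eta> \<omega>) \<partial>N)"
  proof (rule LIMSEQ_I)
    fix e :: real assume e: "0 < e"
    have "eventually (\<lambda>n. (\<integral>\<omega>. \<bar>B\<bar> + g (\<eta> \<omega>) \<partial>N) - e < (\<integral>\<omega>. \<bar>B\<bar> + g (\<xi> n \<omega>) \<partial>M n)) sequentially"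
      by (rule liminf_expectation_point_process[OF \<xi> \<eta> _ simple gp _ C e], fact fdd, fact bp)
    moreover
    have "eventually (\<lambda>n. (\<integral>\<omega>. \<bar>B\<bar> - g (\<eta> \<omega>) \<partial>N) - e < (\<integral>\<omega>. \<bar>B\<bar> - g (\<xi> n \<omega>) \<partial>M n)) sequentially"
      by (rule liminf_expectation_point_process[OF \<xi> \<eta> _ simple gm _ C e], fact fdd, fact bm)
    ultimately
    have "eventually (\<lambda>n. norm ((\<integral>\<omega>. g (\<xi> n \<omega>) \<partial>M n) - (\<integral>\<omega>. g (\<eta> \<omega>) \<partial>N)) < e) sequentially"
      by eventually_elim (simp add: expect[OF \<xi>] expect[OF \<eta>] abs_less_iff)
    then show "\<exists>no. \<forall>n\<ge>no. norm ((\<integral>\<omega>. g (\<xi> n \<omega>) \<partial>M n) - (\<integral>\<omega>. g (\<eta> \<omega>) \<partial>N)) < e"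
      by (simp add: eventually_sequentially)
  qed
qed

section \<open>The scale-invariant Poisson process on the grid\<close>

lemma (in prob_space) prob_indep_vars_Ball:
  assumes ind: "indep_vars (\<lambda>_. N) Y J" and J: "finite J" and A: "\<And>j. j \<in> J \<Longrightarrow> A j \<in> sets N"
  shows "\<P>(\<omega> in M. \<forall>j\<in>J. Y j \<omega> \<in> A j) = (\<Prod>j\<in>J. \<P>(\<omega> in M. Y j \<omega> \<in> A j))"
proof (cases "J = {}")
  case True
  then show ?thesis by (simp add: prob_space)
next
  case False
  have "{\<omega> \<in> space M. \<forall>j\<in>J. Y j \<omega> \<in> A j} = (\<Inter>j\<in>J. Y j -` A j \<inter> space M)"
    using False by auto
  moreover have "prob (\<Inter>j\<in>J. Y j -` A j \<inter> space M) = (\<Prod>j\<in>J. prob (Y j -` A j \<inter> space M))"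
    by (rule indep_varsD[OF ind False J]) (use A in auto)
  moreover have "Y j -` A j \<inter> space M = {\<omega> \<in> space M. Y j \<omega> \<in> A j}" for j by auto
  ultimately show ?thesis by simp
qed

lemma measure_scale_invariant_intensity:
  assumes "0 < a" "a \<le> b" "0 < c"
  shows "measure (scale_invariant_intensity c) {a<..b} = c * ln (b / a)"
proof -
  have [measurable]: "{a<..b} \<in> sets (restrict_space lborel {0<..})"
    using assms by (subst sets_restrict_space_iff) auto
  have "emeasure (scale_invariant_intensity c) {a<..b} =
      (\<integral>\<^sup>+x. ennreal (c / x) * indicator {a<..b} x \<partial>restrict_space lborel {0<..})"
    unfolding scale_invariant_intensity_def
    by (intro emeasure_density) (auto intro!: measurable_restrict_space1)
  also have "\<dots> = (\<integral>\<^sup>+x. ennreal (c / x) * indicator {a<..b} x * indicator {0<..} x \<partial>lborel)"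
    by (rule nn_integral_restrict_space) auto
  also have "\<dots> = (\<integral>\<^sup>+x. ennreal (c / x) * indicator {a..b} x \<partial>lborel)"
    using AE_lborel_singleton[of a] assms
    by (intro nn_integral_cong_AE) (auto simp: indicator_def)
  also have "\<dots> = c * ln b - c * ln a"
    using assms by (intro nn_integral_FTC_Icc) (auto intro!: derivative_eq_intros)
  also have "c * ln b - c * ln a = c * ln (b / a)"
    using assms by (simp add: ln_div algebra_simps)
  finally show ?thesis using assms by (simp add: measure_def)
qed

lemma poisson_process_interval:
  assumes \<eta>: "poisson_process N {0<..} (scale_invariant_intensity c) \<eta>"
    and "0 < a" "a \<le> b" "0 < c"
  shows "\<P>(\<omega> in N. emeasure (\<eta> \<omega>) {a<..b} = of_nat k) =
    (c * ln (b / a)) ^ k / fact k * exp (- (c * ln (b / a)))"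
  using \<eta> relcompact_interval[OF \<open>0 < a\<close>, of b] measure_scale_invariant_intensity[OF assms(2-4)]
  unfolding poisson_process_def by simp

lemma poisson_process_grid_cell:
  assumes \<eta>: "poisson_process N {0<..} (scale_invariant_intensity c) \<eta>" and "0 < c"
  shows "\<P>(\<omega> in N. emeasure (\<eta> \<omega>) (grid_cell m j) = of_nat k) = (c / 2 ^ m) ^ k / fact k * exp (- (c / 2 ^ m))"
  using poisson_process_interval[OF \<eta> grid_point_pos less_imp_le[OF grid_point_less_Suc] \<open>0 < c\<close>, of m j k]
  by (simp add: grid_cell_def ln_grid_ratio)

lemma grid_counts_eq_iff:
  assumes "\<mu> \<in> locally_finite_counting_measures {0<..}" "length l = grid_size m"
  shows "grid_counts m \<mu> = l \<longleftrightarrow> (\<forall>j\<in>{..<grid_size m}. emeasure \<mu> (grid_cell m j) = of_nat (l ! j))"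
proof -
  have "emeasure \<mu> (grid_cell m j) = of_nat (grid_counts m \<mu> ! j)" if "j < grid_size m" for j
    using measure_grid_cell_eq_nth[OF assms(1) that]
    by (rule_tac counting_measure_of_nat[OF assms(1) relcompact_grid_cell[of m j]]) simp
  then show ?thesis using assms(2) by (auto simp: list_eq_iff_nth_eq)
qed

lemma poisson_processD:
  assumes "poisson_process N S \<mu> \<eta>"
  shows "point_process N S \<eta>"
    "finite I \<Longrightarrow> B ` I \<subseteq> relcompact_borel S \<Longrightarrow> disjoint_family_on B (I :: nat set) \<Longrightarrow>
      prob_space.indep_vars N (\<lambda>_. borel) (\<lambda>i \<omega>. emeasure (\<eta> \<omega>) (B i)) I"
  using assms by (auto simp: poisson_process_def)

lemma poisson_process_grid_counts:
  assumes \<eta>: "poisson_process N {0<..} (scale_invariant_intensity c) \<eta>" and "0 < c"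
    and l: "length l = grid_size m"
  shows "\<P>(\<omega> in N. grid_counts m (\<eta> \<omega>) = l) =
    (\<Prod>j<grid_size m. (c / 2 ^ m) ^ (l ! j) / fact (l ! j) * exp (- (c / 2 ^ m)))"
proof -
  note pp = poisson_processD(1)[OF \<eta>]
  interpret N: prob_space N by (rule point_processD(1)[OF pp])
  have "\<P>(\<omega> in N. grid_counts m (\<eta> \<omega>) = l) =
      \<P>(\<omega> in N. \<forall>j\<in>{..<grid_size m}. emeasure (\<eta> \<omega>) (grid_cell m j) \<in> {of_nat (l ! j)})"
    using grid_counts_eq_iff[OF point_processD(2)[OF pp] l]
    by (intro arg_cong[where f=N.prob] Collect_cong) auto
  also have "\<dots> = (\<Prod>j<grid_size m. \<P>(\<omega> in N. emeasure (\<eta> \<omega>) (grid_cell m j) \<in> {of_nat (l ! j)}))"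
    using disjoint_family_grid_cell[of m]
    by (intro N.prob_indep_vars_Ball[where N=borel] poisson_processD(2)[OF \<eta>])
       (auto simp: relcompact_grid_cell disjoint_family_on_def)
  also have "\<dots> = (\<Prod>j<grid_size m. (c / 2 ^ m) ^ (l ! j) / fact (l ! j) * exp (- (c / 2 ^ m)))"
    using poisson_process_grid_cell[OF \<eta> \<open>0 < c\<close>] by simp
  finally show ?thesis .
qed

text \<open>
  A cell has two or more points with probability \<open>1 - (1 + x) exp (-x) \<le> x\<^sup>2\<close> for \<open>x = c / 2 ^ m\<close>, and
  there are \<open>2 m 2\<^sup>m\<close> cells, so a union bound suffices.
\<close>

lemma poisson_process_simple_on_grid:
  assumes \<eta>: "poisson_process N {0<..} (scale_invariant_intensity c) \<eta>" and "0 < c"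
  shows "(\<lambda>m. \<P>(\<omega> in N. \<not> set (grid_counts m (\<eta> \<omega>)) \<subseteq> {0, 1})) \<longlonglongrightarrow> 0"
proof (rule tendsto_sandwich[where f="\<lambda>_. 0"])
  note pp = poisson_processD(1)[OF \<eta>]
  interpret N: prob_space N by (rule point_processD(1)[OF pp])
  show "\<forall>\<^sub>F m in sequentially. \<P>(\<omega> in N. \<not> set (grid_counts m (\<eta> \<omega>)) \<subseteq> {0, 1})
      \<le> 2 * c ^ 2 * (real m * (1 / 2) ^ m)"
  proof (intro always_eventually allI)
    fix m
    define x where "x = c / 2 ^ m"
    define E where "E j k = {\<omega> \<in> space N. emeasure (\<eta> \<omega>) (grid_cell m j) = of_nat k}" for j k
    have E_sets: "E j k \<in> sets N" for j k
    proof -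
      have [measurable]: "(\<lambda>\<omega>. emeasure (\<eta> \<omega>) (grid_cell m j)) \<in> borel_measurable N"
        by (rule point_processD(3)[OF pp relcompact_borelD[OF relcompact_grid_cell]])
      show ?thesis unfolding E_def by measurable
    qed
    have pE: "N.prob (E j 0) = exp (- x)" "N.prob (E j 1) = x * exp (- x)" for j
      using poisson_process_grid_cell[OF \<eta> \<open>0 < c\<close>, of m j 0] poisson_process_grid_cell[OF \<eta> \<open>0 < c\<close>, of m j 1]
      by (simp_all add: E_def x_def)
    have "N.prob {\<omega> \<in> space N. \<not> set (grid_counts m (\<eta> \<omega>)) \<subseteq> {0, 1}} \<le>
        N.prob (\<Union>j<grid_size m. space N - (E j 0 \<union> E j 1))"
    proof (rule N.finite_measure_mono)
      show "{\<omega> \<in> space N. \<not> set (grid_counts m (\<eta> \<omega>)) \<subseteq> {0, 1}} \<subseteq> (\<Union>j<grid_size m. space N - (E j 0 \<union> E j 1))"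
      proof
        fix \<omega> assume "\<omega> \<in> {\<omega> \<in> space N. \<not> set (grid_counts m (\<eta> \<omega>)) \<subseteq> {0, 1}}"
        then obtain k where \<omega>: "\<omega> \<in> space N" and k: "k \<in> set (grid_counts m (\<eta> \<omega>))" "k \<notin> {0, 1}"
          by blast
        obtain j where j: "j < grid_size m" "grid_counts m (\<eta> \<omega>) ! j \<notin> {0, 1}"
          using k by (metis in_set_conv_nth length_grid_counts)
        then have "measure (\<eta> \<omega>) (grid_cell m j) \<notin> {0, 1}"
          using measure_grid_cell_eq_nth[OF point_processD(2)[OF pp \<omega>] j(1)] by simp
        then have "\<omega> \<notin> E j 0 \<union> E j 1" by (auto simp: E_def measure_def)
        then show "\<omega> \<in> (\<Union>j<grid_size m. space N - (E j 0 \<union> E j 1))" using \<omega> j by blast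
      qed
      show "(\<Union>j<grid_size m. space N - (E j 0 \<union> E j 1)) \<in> sets N"
        using E_sets by (intro sets.finite_UN sets.compl_sets sets.Un) auto
    qed
    also have "\<dots> \<le> (\<Sum>j<grid_size m. N.prob (space N - (E j 0 \<union> E j 1)))"
      using E_sets by (intro N.finite_measure_subadditive_finite) auto
    also have "\<dots> \<le> (\<Sum>j<grid_size m. x ^ 2)"
    proof (rule sum_mono)
      fix j
      have "E j 0 \<inter> E j 1 = {}" by (auto simp: E_def)
      then have "N.prob (E j 0 \<union> E j 1) = (1 + x) * exp (- x)"
        using E_sets pE by (subst N.finite_measure_Union) (auto simp: algebra_simps)
      then have compl: "N.prob (space N - (E j 0 \<union> E j 1)) = 1 - (1 + x) * exp (- x)"
        using E_sets by (subst N.prob_compl) auto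
      have "(1 + x) * (1 - x) \<le> (1 + x) * exp (- x)"
        using exp_ge_add_one_self[of "- x"] \<open>0 < c\<close> by (intro mult_left_mono) (auto simp: x_def)
      then show "N.prob (space N - (E j 0 \<union> E j 1)) \<le> x ^ 2"
        unfolding compl by (simp add: algebra_simps power2_eq_square)
    qed
    also have "\<dots> = 2 * c ^ 2 * (real m * (1 / 2) ^ m)"
      by (simp add: grid_size_def x_def power_divide power2_eq_square)
    finally show "\<P>(\<omega> in N. \<not> set (grid_counts m (\<eta> \<omega>)) \<subseteq> {0, 1}) \<le> 2 * c ^ 2 * (real m * (1 / 2) ^ m)" .
  qed
  have "(\<lambda>m. real m * (1 / 2 :: real) ^ m) \<longlonglongrightarrow> 0"
    using powser_times_n_limit_0[of "1 / 2 :: real"] by simp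
  from tendsto_mult[OF tendsto_const this, of "2 * c ^ 2"]
  show "(\<lambda>m. 2 * c ^ 2 * (real m * (1 / 2) ^ m)) \<longlonglongrightarrow> 0" by simp
qed simp_all

section \<open>The rescaled process as a point process\<close>

lemma dirac_series:
  fixes S :: "'a::metric_space set"
  shows space_dirac_series: "space (dirac_series S w x) = S"
    and sets_dirac_series: "sets (dirac_series S w x) = sets (restrict_space borel S)"
    and emeasure_dirac_series: "B \<in> sets (restrict_space borel S) \<Longrightarrow>
      emeasure (dirac_series S w x) B = (\<Sum>k. of_nat (w k) * indicator B (x k))"
proof -
  interpret R: sigma_algebra S "sets (restrict_space borel S)"
    using sets.sigma_algebra_axioms[of "restrict_space borel S"] by (simp add: space_restrict_space)
  show "space (dirac_series S w x) = S" "sets (dirac_series S w x) = sets (restrict_space borel S)"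
    by (simp_all add: dirac_series_def)
  let ?\<mu> = "\<lambda>B. \<Sum>k. of_nat (w k) * indicator B (x k) :: ennreal"
  \<comment> \<open>Countable additivity is the exchange of two sums; one of them is read as an integral over \<open>\<nat>\<close>.\<close>
  have "countably_additive (sets (restrict_space borel S)) ?\<mu>"
  proof (rule countably_additiveI)
    fix A :: "nat \<Rightarrow> 'a set" assume disj: "disjoint_family A"
    have "(\<Sum>i. ?\<mu> (A i)) = (\<Sum>i. \<integral>\<^sup>+k. of_nat (w k) * indicator (A i) (x k) \<partial>count_space UNIV)"
      by (simp add: nn_integral_count_space_nat)
    also have "\<dots> = (\<integral>\<^sup>+k. (\<Sum>i. of_nat (w k) * indicator (A i) (x k)) \<partial>count_space UNIV)"
      by (rule nn_integral_suminf[symmetric]) simp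
    also have "\<dots> = (\<integral>\<^sup>+k. of_nat (w k) * indicator (\<Union>i. A i) (x k) \<partial>count_space UNIV)"
      using suminf_indicator[OF disj] by (simp add: ennreal_suminf_cmult)
    also have "\<dots> = ?\<mu> (\<Union>i. A i)" by (simp add: nn_integral_count_space_nat)
    finally show "(\<Sum>i. ?\<mu> (A i)) = ?\<mu> (\<Union>i. A i)" .
  qed
  then show "emeasure (dirac_series S w x) B = ?\<mu> B" if "B \<in> sets (restrict_space borel S)"
    unfolding dirac_series_def
    by (intro emeasure_measure_of_sigma R.sigma_algebra_axioms that) (auto simp: positive_def)
qed

lemma finite_scaled_positions:
  fixes z :: "nat \<Rightarrow> real"
  assumes z: "filterlim z at_top sequentially" "\<And>k. 0 < z k" and B: "B \<in> relcompact_borel {0<..}"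
  shows "finite {k. z k / z n \<in> B}"
proof -
  obtain K where "compact K" "B \<subseteq> K" using B by (auto simp: relcompact_borel_def)
  then obtain b where b: "\<And>x. x \<in> B \<Longrightarrow> x \<le> b"
    by (meson abs_le_D1 bounded_real compact_imp_bounded subsetD)
  have "eventually (\<lambda>k. b * z n < z k) sequentially"
    using z(1) by (auto simp: filterlim_at_top_dense)
  then obtain k0 where "\<And>k. k0 \<le> k \<Longrightarrow> b * z n < z k" by (auto simp: eventually_sequentially)
  then have "{k. z k / z n \<in> B} \<subseteq> {..<k0}"
    using b z(2)[of n] by (force simp: field_simps not_less[symmetric])
  then show ?thesis by (rule finite_subset) simp
qed

lemma emeasure_scaled_process:
  assumes z: "filterlim z at_top sequentially" "\<And>k. 0 < z k" and B: "B \<in> relcompact_borel {0<..}"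
  shows "emeasure (scaled_process z X n \<omega>) B = of_nat (\<Sum>k | z k / z n \<in> B. X k \<omega>)"
proof -
  have "emeasure (scaled_process z X n \<omega>) B = (\<Sum>k. of_nat (X k \<omega>) * indicator B (z k / z n))"
    unfolding scaled_process_def by (rule emeasure_dirac_series[OF relcompact_borelD[OF B]])
  also have "\<dots> = (\<Sum>k | z k / z n \<in> B. of_nat (X k \<omega>) * indicator B (z k / z n))"
    by (rule suminf_finite[OF finite_scaled_positions[OF z B]]) simp
  finally show ?thesis by simp
qed

lemma point_process_scaled_process:
  assumes z: "filterlim z at_top sequentially" "\<And>k. 0 < z k"
    and M: "prob_space M" and X: "\<And>k. X k \<in> measurable M (count_space UNIV)"
  shows "point_process M {0<..} (scaled_process z X n)"
  unfolding point_process_def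
proof (intro conjI ballI M)
  fix \<omega>
  show "scaled_process z X n \<omega> \<in> locally_finite_counting_measures {0<..}"
    using emeasure_scaled_process[OF z, of _ X n \<omega>]
    by (auto simp: locally_finite_counting_measures_def locally_finite_measures_def
        scaled_process_def space_dirac_series sets_dirac_series simp del: of_nat_sum)
       (simp_all add: less_top[symmetric] flip: of_nat_sum)
next
  fix B assume "B \<in> sets (restrict_space borel {0::real<..})"
  then have "emeasure (scaled_process z X n \<omega>) B = (\<Sum>k. of_nat (X k \<omega>) * indicator B (z k / z n))" for \<omega>
    by (simp add: scaled_process_def emeasure_dirac_series)
  moreover have "(\<lambda>\<omega>. \<Sum>k. of_nat (X k \<omega>) * indicator B (z k / z n) :: ennreal) \<in> borel_measurable M"
    by (intro borel_measurable_suminf_order borel_measurable_times_ennreal measurable_compose[OF X]) auto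
  ultimately show "(\<lambda>\<omega>. emeasure (scaled_process z X n \<omega>) B) \<in> borel_measurable M" by simp
qed

section \<open>Sums of independent variables with natural values\<close>

text \<open>
  The probabilities of the values \<open>0\<close> and \<open>1\<close> of such a sum are explicit in \<open>q\<^sup>0\<close> and \<open>q\<^sup>1\<close>; they are
  exactly the two quantities that occur in the limit condition.
\<close>

lemma (in prob_space) prob_sum_eq_0:
  fixes X :: "'i \<Rightarrow> 'a \<Rightarrow> nat"
  assumes ind: "indep_vars (\<lambda>_. count_space UNIV) X A" and A: "finite A"
  shows "\<P>(\<omega> in M. (\<Sum>k\<in>A. X k \<omega>) = 0) = (\<Prod>k\<in>A. \<P>(\<omega> in M. X k \<omega> = 0))"
proof -
  have "\<P>(\<omega> in M. (\<Sum>k\<in>A. X k \<omega>) = 0) = \<P>(\<omega> in M. \<forall>k\<in>A. X k \<omega> \<in> {0})"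
    using A by (intro arg_cong[where f=prob]) auto
  also have "\<dots> = (\<Prod>k\<in>A. \<P>(\<omega> in M. X k \<omega> \<in> {0}))"
    by (rule prob_indep_vars_Ball[OF ind A]) simp
  finally show ?thesis by simp
qed

text \<open>
  The sum is \<open>1\<close> if and only if one variable, say with index \<open>k\<close>, is \<open>1\<close> and the others vanish. The
  quotient exchanges the factor of \<open>k\<close> in the void probability.
\<close>

lemma (in prob_space) prob_sum_eq_1:
  fixes X :: "'i \<Rightarrow> 'a \<Rightarrow> nat"
  assumes ind: "indep_vars (\<lambda>_. count_space UNIV) X A" and A: "finite A"
    and pos: "(\<Prod>k\<in>A. \<P>(\<omega> in M. X k \<omega> = 0)) \<noteq> 0"
  shows "\<P>(\<omega> in M. (\<Sum>k\<in>A. X k \<omega>) = 1) =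
    (\<Prod>k\<in>A. \<P>(\<omega> in M. X k \<omega> = 0)) * (\<Sum>k\<in>A. \<P>(\<omega> in M. X k \<omega> = 1) / \<P>(\<omega> in M. X k \<omega> = 0))"
proof -
  let ?q = "\<lambda>i k. \<P>(\<omega> in M. X k \<omega> = i)"
  define E where "E k = {\<omega> \<in> space M. \<forall>j\<in>A. X j \<omega> \<in> {if j = k then 1 else 0}}" for k
  have X: "X k \<in> measurable M (count_space UNIV)" if "k \<in> A" for k
    using ind that by (auto simp: indep_vars_def)
  have E_sets: "E k \<in> sets M" for k
    unfolding E_def using A by (intro sets.sets_Collect_finite_All measurable_sets_Collect[OF X]) auto
  have "(X k \<omega> = 1 \<and> (\<forall>j\<in>A. k \<noteq> j \<longrightarrow> X j \<omega> = 0)) = (\<forall>j\<in>A. X j \<omega> \<in> {if j = k then 1 else 0})"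
    if "k \<in> A" for k \<omega>
    using that by (auto split: if_splits)
  then have "{\<omega> \<in> space M. (\<Sum>k\<in>A. X k \<omega>) = 1} = (\<Union>k\<in>A. E k)"
    unfolding sum_eq_1_iff[OF A] E_def by blast
  then have "\<P>(\<omega> in M. (\<Sum>k\<in>A. X k \<omega>) = 1) = prob (\<Union>k\<in>A. E k)" by simp
  also have "\<dots> = (\<Sum>k\<in>A. prob (E k))"
  proof (rule finite_measure_finite_Union[OF A])
    show "disjoint_family_on E A"
      unfolding disjoint_family_on_def
    proof (intro ballI impI equals0I)
      fix i k \<omega> assume "i \<in> A" "k \<in> A" "i \<noteq> k" "\<omega> \<in> E i \<inter> E k"
      then have "X i \<omega> = 1" "X i \<omega> = 0" by (auto simp: E_def)
      then show False by simp
    qed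
  qed (use E_sets in auto)
  also have "\<dots> = (\<Sum>k\<in>A. (\<Prod>j\<in>A. ?q 0 j) * (?q 1 k / ?q 0 k))"
  proof (rule sum.cong)
    fix k assume k: "k \<in> A"
    then have q0: "?q 0 k \<noteq> 0" using pos A by auto
    have "prob (E k) = (\<Prod>j\<in>A. \<P>(\<omega> in M. X j \<omega> \<in> {if j = k then 1 else 0}))"
      unfolding E_def by (rule prob_indep_vars_Ball[OF ind A]) simp
    also have "\<dots> = ?q 1 k * (\<Prod>j\<in>A - {k}. ?q 0 j)"
      using A k by (subst prod.remove[of _ k]) (auto intro!: prod.cong)
    also have "\<dots> = (\<Prod>j\<in>A. ?q 0 j) * (?q 1 k / ?q 0 k)"
      using A k q0 by (subst prod.remove[of A k]) auto
    finally show "prob (E k) = (\<Prod>j\<in>A. ?q 0 j) * (?q 1 k / ?q 0 k)" .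
  qed simp
  finally show ?thesis by (simp add: sum_distrib_left)
qed

lemma (in prob_space) prob_disjoint_sums:
  fixes X :: "'i \<Rightarrow> 'a \<Rightarrow> nat"
  assumes ind: "indep_vars (\<lambda>_. count_space UNIV) X UNIV"
    and J: "finite J" "disjoint_family_on A J" and A: "\<And>j. j \<in> J \<Longrightarrow> finite (A j)"
  shows "\<P>(\<omega> in M. \<forall>j\<in>J. (\<Sum>k\<in>A j. X k \<omega>) = l j) = (\<Prod>j\<in>J. \<P>(\<omega> in M. (\<Sum>k\<in>A j. X k \<omega>) = l j))"
proof -
  have "indep_vars (\<lambda>j. PiM (A j) (\<lambda>_. count_space UNIV)) (\<lambda>j \<omega>. restrict (\<lambda>k. X k \<omega>) (A j)) J"
    by (rule indep_vars_restrict[OF ind _ J(2)]) simp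
  then have "indep_vars (\<lambda>_. count_space UNIV)
      (\<lambda>j \<omega>. \<Sum>k\<in>A j. restrict (\<lambda>k. X k \<omega>) (A j) k) J"
    by (rule indep_vars_compose2[where Y="\<lambda>j f. \<Sum>k\<in>A j. f k"])
       (intro measurable_sum_nat measurable_component_singleton)
  also have "(\<lambda>j \<omega>. \<Sum>k\<in>A j. restrict (\<lambda>k. X k \<omega>) (A j) k) = (\<lambda>j \<omega>. \<Sum>k\<in>A j. X k \<omega>)"
    by (intro ext sum.cong) auto
  finally show ?thesis
    using prob_indep_vars_Ball[OF _ J(1), of "count_space UNIV" "\<lambda>j \<omega>. \<Sum>k\<in>A j. X k \<omega>" "\<lambda>j. {l j}"] by simp
qed

section \<open>Sufficiency of the limit condition\<close>

text \<open>
  Lower limits are expressed by ordinary limits of \<open>min (x n) p\<close>, since these pass through finite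
  sums and products of non-negative terms.
\<close>

lemma tendsto_min_of_le_liminf:
  fixes x :: "nat \<Rightarrow> real"
  assumes "ereal p \<le> liminf (\<lambda>n. ereal (x n))"
  shows "(\<lambda>n. min (x n) p) \<longlonglongrightarrow> p"
proof (rule order_tendstoI)
  fix y assume "y < p"
  then have "ereal y < liminf (\<lambda>n. ereal (x n))" using assms by (metis ereal_less_eq(3) less_ereal.simps(1) less_le_trans)
  then have "eventually (\<lambda>n. ereal y < ereal (x n)) sequentially" by (rule less_LiminfD)
  then show "eventually (\<lambda>n. y < min (x n) p) sequentially"
    by eventually_elim (simp add: \<open>y < p\<close>)
next
  fix y assume "p < y"
  then show "eventually (\<lambda>n. min (x n) p < y) sequentially"
    by (intro always_eventually allI) (simp add: min_less_iff_disj)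
qed

lemma tendsto_min_of_lower_bound:
  fixes x y :: "nat \<Rightarrow> real"
  assumes "y \<longlonglongrightarrow> p" "eventually (\<lambda>n. y n \<le> x n) sequentially"
  shows "(\<lambda>n. min (x n) p) \<longlonglongrightarrow> p"
proof (rule tendsto_sandwich[where h="\<lambda>_. p"])
  show "(\<lambda>n. min (y n) p) \<longlonglongrightarrow> p" using tendsto_min[OF assms(1) tendsto_const, of p] by simp
  show "eventually (\<lambda>n. min (y n) p \<le> min (x n) p) sequentially"
    using assms(2) by eventually_elim simp
qed simp_all

lemma scaled_positions_interval:
  fixes z :: "nat \<Rightarrow> real"
  assumes "\<And>k. 0 < z k"
  shows "{k. z k / z n \<in> {a<..b}} = {k. a * z n < z k \<and> z k \<le> b * z n}"
  using assms[of n] by (simp add: pos_less_divide_eq pos_divide_le_eq)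

lemma scaled_process_interval:
  assumes z: "filterlim z at_top sequentially" "\<And>k. 0 < z k" and a: "0 < a"
  shows "emeasure (scaled_process z X n \<omega>) {a<..b} = of_nat (\<Sum>k | a * z n < z k \<and> z k \<le> b * z n. X k \<omega>)"
    and "measure (scaled_process z X n \<omega>) {a<..b} = real (\<Sum>k | a * z n < z k \<and> z k \<le> b * z n. X k \<omega>)"
    and "finite {k. a * z n < z k \<and> z k \<le> b * z n}"
proof -
  show *: "emeasure (scaled_process z X n \<omega>) {a<..b} = of_nat (\<Sum>k | a * z n < z k \<and> z k \<le> b * z n. X k \<omega>)"
    using emeasure_scaled_process[OF z relcompact_interval[OF a], of X n \<omega> b]
    unfolding scaled_positions_interval[of z, OF z(2)] .
  show "measure (scaled_process z X n \<omega>) {a<..b} = real (\<Sum>k | a * z n < z k \<and> z k \<le> b * z n. X k \<omega>)"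
    unfolding measure_def * by (metis enn2real_of_nat)
  show "finite {k. a * z n < z k \<and> z k \<le> b * z n}"
    using finite_scaled_positions[OF z relcompact_interval[OF a], of n b]
    unfolding scaled_positions_interval[of z, OF z(2)] .
qed

text \<open>
  With \<open>r = c * ln (b / a)\<close>, the first condition is the convergence of the void probability to \<open>exp (-r)\<close>.
  The probability of exactly one point is the void probability times the sum in the second condition, so its
  lower limit is at least \<open>r * exp (-r)\<close>.
\<close>

lemma poisson_limit_condition_cell:
  assumes M: "prob_space M" and z: "filterlim z at_top sequentially" "\<And>k. 0 < z k"
    and ind: "prob_space.indep_vars M (\<lambda>_. count_space UNIV) X UNIV"
    and cond: "poisson_limit_condition M z X c" and ab: "0 < a" "a < b" and i: "i \<in> {0, 1}"
  shows "(\<lambda>n. min (\<P>(\<omega> in M. emeasure (scaled_process z X n \<omega>) {a<..b} = of_nat i))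
      ((c * ln (b / a)) ^ i / fact i * exp (- (c * ln (b / a)))))
    \<longlonglongrightarrow> (c * ln (b / a)) ^ i / fact i * exp (- (c * ln (b / a)))"
proof -
  interpret prob_space M by (rule M)
  define A where "A n = {k. a * z n < z k \<and> z k \<le> b * z n}" for n
  define p where "p n = (\<Prod>k\<in>A n. \<P>(\<omega> in M. X k \<omega> = 0))" for n
  define s where "s n = (\<Sum>k\<in>A n. \<P>(\<omega> in M. X k \<omega> = 1) / \<P>(\<omega> in M. X k \<omega> = 0))" for n
  define r where "r = c * ln (b / a)"
  have A: "finite (A n)" for n unfolding A_def by (rule scaled_process_interval(3)[OF z ab(1)])
  have indA: "indep_vars (\<lambda>_. count_space UNIV) X (A n)" for n by (rule indep_vars_subset[OF ind]) simp
  have prob_eq: "\<P>(\<omega> in M. emeasure (scaled_process z X n \<omega>) {a<..b} = of_nat i) = \<P>(\<omega> in M. (\<Sum>k\<in>A n. X k \<omega>) = i)" for n i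
    unfolding scaled_process_interval(1)[OF z ab(1)] A_def by (simp del: of_nat_sum)
  note cond_ab = cond[unfolded poisson_limit_condition_def, rule_format, OF conjI[OF ab]]
  have "(a / b) powr c = exp (- r)"
    using ab by (simp add: powr_def r_def ln_div algebra_simps)
  then have p: "p \<longlonglongrightarrow> exp (- r)"
    using conjunct1[OF cond_ab] by (simp add: p_def[abs_def] A_def)
  have s: "(\<lambda>n. min (s n) r) \<longlonglongrightarrow> r"
    unfolding s_def A_def r_def by (rule tendsto_min_of_le_liminf[OF conjunct2[OF cond_ab]])
  show ?thesis
  proof (cases "i = 0")
    case True
    have "p n = \<P>(\<omega> in M. (\<Sum>k\<in>A n. X k \<omega>) = 0)" for n
      unfolding p_def by (rule prob_sum_eq_0[OF indA A, symmetric])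
    then show ?thesis
      unfolding prob_eq using p True by (intro tendsto_min_of_lower_bound[of p]) (auto simp: r_def)
  next
    case False
    then have i: "i = 1" using i by simp
    have "eventually (\<lambda>n. p n > 0) sequentially" using p by (rule order_tendstoD) simp
    then have "eventually (\<lambda>n. p n * min (s n) r \<le> \<P>(\<omega> in M. (\<Sum>k\<in>A n. X k \<omega>) = 1)) sequentially"
    proof eventually_elim
      case (elim n)
      then have "p n * min (s n) r \<le> p n * s n" by (intro mult_left_mono) auto
      also have "\<dots> = \<P>(\<omega> in M. (\<Sum>k\<in>A n. X k \<omega>) = 1)"
        unfolding p_def s_def by (rule prob_sum_eq_1[OF indA A, symmetric]) (use elim in \<open>simp add: p_def\<close>)
      finally show ?case .
    qed
    moreover have "(\<lambda>n. p n * min (s n) r) \<longlonglongrightarrow> r * exp (- r)"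
      using tendsto_mult[OF p s] by (simp add: mult.commute)
    ultimately show ?thesis
      unfolding prob_eq i by (intro tendsto_min_of_lower_bound[of "\<lambda>n. p n * min (s n) r"]) (auto simp: r_def)
  qed
qed

lemma scaled_process_grid_counts:
  assumes M: "prob_space M" and z: "filterlim z at_top sequentially" "\<And>k. 0 < z k"
    and ind: "prob_space.indep_vars M (\<lambda>_. count_space UNIV) X UNIV"
    and l: "length l = grid_size m"
  shows "\<P>(\<omega> in M. grid_counts m (scaled_process z X n \<omega>) = l) =
    (\<Prod>j<grid_size m. \<P>(\<omega> in M. emeasure (scaled_process z X n \<omega>) (grid_cell m j) = of_nat (l ! j)))"
proof -
  interpret prob_space M by (rule M)
  have X: "X k \<in> measurable M (count_space UNIV)" for k
    using ind by (auto simp: indep_vars_def)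
  note pp = point_process_scaled_process[where X=X and n=n, OF z M X]
  define A where "A j = {k. z k / z n \<in> grid_cell m j}" for j
  have em: "emeasure (scaled_process z X n \<omega>) (grid_cell m j) = of_nat (\<Sum>k\<in>A j. X k \<omega>)" for \<omega> j
    unfolding A_def by (rule emeasure_scaled_process[OF z relcompact_grid_cell])
  have iff: "emeasure (scaled_process z X n \<omega>) (grid_cell m j) = of_nat (l ! j) \<longleftrightarrow> (\<Sum>k\<in>A j. X k \<omega>) = l ! j" for \<omega> j
    unfolding em by (rule of_nat_eq_iff)
  have "\<P>(\<omega> in M. grid_counts m (scaled_process z X n \<omega>) = l) =
      \<P>(\<omega> in M. \<forall>j\<in>{..<grid_size m}. (\<Sum>k\<in>A j. X k \<omega>) = l ! j)"
    using grid_counts_eq_iff[OF point_processD(2)[OF pp] l] iff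
    by (intro arg_cong[where f=prob] Collect_cong) auto
  also have "\<dots> = (\<Prod>j<grid_size m. \<P>(\<omega> in M. (\<Sum>k\<in>A j. X k \<omega>) = l ! j))"
    using disjoint_family_grid_cell[of m] finite_scaled_positions[OF z relcompact_grid_cell]
    by (intro prob_disjoint_sums[OF ind]) (auto simp: A_def disjoint_family_on_def)
  finally show ?thesis unfolding iff .
qed

lemma converges_vaguely_if_poisson_limit_condition:
  assumes M: "prob_space M" and z: "filterlim z at_top sequentially" "\<And>k. 0 < z k"
    and ind: "prob_space.indep_vars M (\<lambda>_. count_space UNIV) X UNIV"
    and c: "0 < c" and \<eta>: "poisson_process N {0<..} (scale_invariant_intensity c) \<eta>"
    and cond: "poisson_limit_condition M z X c"
  shows "converges_vaguely_in_distribution {0<..} (\<lambda>_. M) (scaled_process z X) N \<eta>"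
proof (rule converges_vaguely_if_grid_counts)
  interpret prob_space M by (rule M)
  have "X k \<in> measurable M (count_space UNIV)" for k
    using ind by (auto simp: indep_vars_def)
  then show "point_process M {0<..} (scaled_process z X n)" for n
    by (rule point_process_scaled_process[OF z M])
  show "point_process N {0<..} \<eta>" by (rule poisson_processD(1)[OF \<eta>])
  show "(\<lambda>m. \<P>(\<omega> in N. \<not> set (grid_counts m (\<eta> \<omega>)) \<subseteq> {0, 1})) \<longlonglongrightarrow> 0"
    by (rule poisson_process_simple_on_grid[OF \<eta> c])
next
  fix m and l :: "nat list" assume l: "length l = grid_size m" "set l \<subseteq> {0, 1}"
  define x where "x n j = \<P>(\<omega> in M. emeasure (scaled_process z X n \<omega>) (grid_cell m j) = of_nat (l ! j))" for n j
  define p where "p j = (c / 2 ^ m) ^ (l ! j) / fact (l ! j) * exp (- (c / 2 ^ m))" for j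
  have "l ! j \<in> {0, 1}" if "j < grid_size m" for j
    using l that by (metis nth_mem subsetD)
  then have "(\<lambda>n. min (x n j) (p j)) \<longlonglongrightarrow> p j" if "j < grid_size m" for j
    using poisson_limit_condition_cell[OF M z ind cond grid_point_pos grid_point_less_Suc, of "l ! j" m j] that
    by (simp add: x_def p_def grid_cell_def ln_grid_ratio)
  then have "(\<lambda>n. \<Prod>j<grid_size m. min (x n j) (p j)) \<longlonglongrightarrow> (\<Prod>j<grid_size m. p j)"
    by (intro tendsto_prod) auto
  moreover have "(\<Prod>j<grid_size m. min (x n j) (p j)) \<le> (\<Prod>j<grid_size m. x n j)" for n
    using c by (intro prod_mono) (auto simp: x_def p_def)
  ultimately have "(\<lambda>n. min (\<Prod>j<grid_size m. x n j) (\<Prod>j<grid_size m. p j)) \<longlonglongrightarrow> (\<Prod>j<grid_size m. p j)"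
    by (intro tendsto_min_of_lower_bound) auto
  then show "(\<lambda>n. min (\<P>(\<omega> in M. grid_counts m (scaled_process z X n \<omega>) = l)) (\<P>(\<omega> in N. grid_counts m (\<eta> \<omega>) = l)))
      \<longlonglongrightarrow> \<P>(\<omega> in N. grid_counts m (\<eta> \<omega>) = l)"
    unfolding scaled_process_grid_counts[OF M z ind l(1)] poisson_process_grid_counts[OF \<eta> c l(1)]
    by (simp add: x_def p_def)
qed

section \<open>Necessity of the limit condition\<close>

lemma continuous_map_vague_integral:
  assumes "f \<in> vague_test_functions S"
  shows "continuous_map (vague_topology S) euclideanreal (\<lambda>\<mu>. \<integral>x. f x \<partial>\<mu>)"
  unfolding continuous_map topspace_vague_topology
proof (intro conjI allI impI)
  fix U :: "real set" assume "openin euclideanreal U"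
  then show "openin (vague_topology S) {\<mu> \<in> locally_finite_measures S. (\<integral>x. f x \<partial>\<mu>) \<in> U}"
    unfolding vague_topology_def using assms by (intro topology_generated_by_Basis) auto
qed simp

text \<open>The piecewise linear function that is \<open>1\<close> on \<open>{q..r}\<close> and vanishes outside \<open>{p..t}\<close>.\<close>

definition trapezoid :: "real \<Rightarrow> real \<Rightarrow> real \<Rightarrow> real \<Rightarrow> real \<Rightarrow> real" where
  "trapezoid p q r t x = max 0 (min 1 (min ((x - p) / (q - p)) ((t - x) / (t - r))))"

lemma trapezoid_bounds:
  assumes "p < q" "r < t"
  shows "indicator {q<..r} x \<le> trapezoid p q r t x" "trapezoid p q r t x \<le> indicator {p<..t} x"
proof -
  have "1 \<le> (x - p) / (q - p)" "1 \<le> (t - x) / (t - r)" if "q < x" "x \<le> r"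
    using that assms by (simp_all add: pos_le_divide_eq)
  then show "indicator {q<..r} x \<le> trapezoid p q r t x" by (auto simp: trapezoid_def indicator_def)
  have "(x - p) / (q - p) \<le> 0 \<or> (t - x) / (t - r) \<le> 0" if "x \<notin> {p<..t}"
    using that assms by (auto simp: not_less not_le intro!: divide_nonpos_pos)
  then show "trapezoid p q r t x \<le> indicator {p<..t} x"
    by (cases "x \<in> {p<..t}") (auto simp: trapezoid_def min_le_iff_disj)
qed

lemma trapezoid_vague_test_function:
  assumes "0 < p" "p < q" "r < t"
  shows "trapezoid p q r t \<in> vague_test_functions {0<..}"
  unfolding vague_test_functions_def
proof (intro CollectI conjI exI ballI)
  show "continuous_on {0<..} (trapezoid p q r t)"
    unfolding trapezoid_def using assms by (intro continuous_intros) auto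
  show "0 \<le> trapezoid p q r t x" for x by (simp add: trapezoid_def)
  show "compact {p..t}" "{p..t} \<subseteq> {0<..}" using assms by auto
  fix x assume "x \<in> {0<..} - {p..t}"
  then have "trapezoid p q r t x \<le> 0"
    using trapezoid_bounds(2)[OF assms(2,3), of x] by auto
  then show "trapezoid p q r t x = 0" by (simp add: trapezoid_def)
qed

text \<open>
  The continuous function that is \<open>1\<close> up to \<open>k\<close>, \<open>0\<close> from \<open>k + 1\<close> on, and linear in between. On
  integers it is the indicator of \<open>{..k}\<close>.
\<close>

definition soft_at_most :: "nat \<Rightarrow> real \<Rightarrow> real" where
  "soft_at_most k y = max 0 (min 1 (real k + 1 - y))"

text \<open>
  The event of at most \<open>k\<close> points in an interval is not vaguely continuous, since points may sit on
  the end points. It is enclosed between two continuous functionals, with slightly larger or smaller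
  intervals. The upper bound needs that the count is an integer: more than \<open>k\<close> points
  means at least \<open>k + 1\<close>.
\<close>

lemma soft_at_most_trapezoid_bounds:
  assumes \<mu>: "\<mu> \<in> locally_finite_counting_measures {0<..}"
    and "0 < p" "p < q" "r < t"
  shows "of_bool (measure \<mu> {p<..t} \<le> real k) \<le> soft_at_most k (\<integral>x. trapezoid p q r t x \<partial>\<mu>)"
    and "soft_at_most k (\<integral>x. trapezoid p q r t x \<partial>\<mu>) \<le> of_bool (measure \<mu> {q<..r} \<le> real k)"
proof -
  note lf = counting_imp_locally_finite[OF \<mu>]
  note int = integrable_vague_test_function[OF lf trapezoid_vague_test_function[OF assms(2-4)]]
  have I: "{a<..b} \<in> sets \<mu>" "emeasure \<mu> {a<..b} < \<infinity>" if "0 < a" for a b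
    using relcompact_interval[OF that, of b] relcompact_borelD locally_finite_measuresD(2,3)[OF lf] by blast+
  have q: "0 < q" using assms by simp
  have "(\<integral>x. indicator {q<..r} x \<partial>\<mu>) \<le> (\<integral>x. trapezoid p q r t x \<partial>\<mu>)"
    using I[OF q] by (intro integral_mono int trapezoid_bounds assms integrable_real_indicator)
  then have lower: "measure \<mu> {q<..r} \<le> (\<integral>x. trapezoid p q r t x \<partial>\<mu>)"
    using I[OF q] by (simp add: sets.Int_space_eq2)
  have "(\<integral>x. trapezoid p q r t x \<partial>\<mu>) \<le> (\<integral>x. indicator {p<..t} x \<partial>\<mu>)"
    using I[OF assms(2)] by (intro integral_mono int trapezoid_bounds assms integrable_real_indicator)
  then have upper: "(\<integral>x. trapezoid p q r t x \<partial>\<mu>) \<le> measure \<mu> {p<..t}"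
    using I[OF assms(2)] by (simp add: sets.Int_space_eq2)
  show "of_bool (measure \<mu> {p<..t} \<le> real k) \<le> soft_at_most k (\<integral>x. trapezoid p q r t x \<partial>\<mu>)"
    using upper by (auto simp: soft_at_most_def)
  obtain i :: nat where i: "measure \<mu> {q<..r} = real i"
    using counting_measure_of_nat[OF \<mu> relcompact_interval[OF q]] by metis
  have "real k + 1 \<le> real i" if "\<not> real i \<le> real k"
    using that by (metis Suc_leI not_le of_nat_Suc of_nat_le_iff of_nat_less_iff add.commute)
  then show "soft_at_most k (\<integral>x. trapezoid p q r t x \<partial>\<mu>) \<le> of_bool (measure \<mu> {q<..r} \<le> real k)"
    using lower i by (auto simp: soft_at_most_def)
qed

lemma continuous_map_soft_at_most_trapezoid:
  assumes "0 < p" "p < q" "r < t"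
  shows "continuous_map (vague_topology {0<..}) euclideanreal (\<lambda>\<mu>. soft_at_most k (\<integral>x. trapezoid p q r t x \<partial>\<mu>))"
proof -
  have "continuous_map euclideanreal euclideanreal (soft_at_most k)"
    unfolding continuous_map_iff_continuous2 soft_at_most_def by (intro continuous_intros)
  from continuous_map_compose[OF continuous_map_vague_integral[OF trapezoid_vague_test_function[OF assms]] this]
  show ?thesis by (simp add: o_def)
qed

lemma expectation_soft_at_most_trapezoid:
  assumes \<xi>: "point_process M {0<..} \<xi>" and pqrt: "0 < p" "p < q" "r < t"
  shows "\<P>(\<omega> in M. measure (\<xi> \<omega>) {p<..t} \<le> real k) \<le> (\<integral>\<omega>. soft_at_most k (\<integral>x. trapezoid p q r t x \<partial>\<xi> \<omega>) \<partial>M)"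
    and "(\<integral>\<omega>. soft_at_most k (\<integral>x. trapezoid p q r t x \<partial>\<xi> \<omega>) \<partial>M) \<le> \<P>(\<omega> in M. measure (\<xi> \<omega>) {q<..r} \<le> real k)"
proof -
  interpret prob_space M by (rule point_processD(1)[OF \<xi>])
  let ?g = "\<lambda>\<mu>. soft_at_most k (\<integral>x. trapezoid p q r t x \<partial>\<mu>)"
  have bnd: "0 \<le> ?g \<nu> \<and> ?g \<nu> \<le> 1" for \<nu> by (simp add: soft_at_most_def)
  have "(\<lambda>\<omega>. ?g (\<xi> \<omega>)) \<in> borel_measurable M"
    by (rule measurable_continuous_point_process[OF \<xi> continuous_map_soft_at_most_trapezoid[OF pqrt], where C=1])
       (use bnd in auto)
  then have int: "integrable M (\<lambda>\<omega>. ?g (\<xi> \<omega>))"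
    using bnd by (intro integrable_const_bound[where B=1]) auto
  have ev: "{\<omega> \<in> space M. measure (\<xi> \<omega>) {a<..b} \<le> real k} \<in> sets M" if "0 < a" for a b
  proof -
    have [measurable]: "(\<lambda>\<omega>. measure (\<xi> \<omega>) {a<..b}) \<in> borel_measurable M"
      by (rule measurable_measure_point_process[OF \<xi> relcompact_borelD[OF relcompact_interval[OF that]]])
    show ?thesis by measurable
  qed
  have prob_eq: "\<P>(\<omega> in M. measure (\<xi> \<omega>) {a<..b} \<le> real k) =
      (\<integral>\<omega>. indicator {\<omega> \<in> space M. measure (\<xi> \<omega>) {a<..b} \<le> real k} \<omega> \<partial>M)" if "0 < a" for a b
    using ev[OF that] by (simp add: sets.Int_space_eq2)
  have q: "0 < q" using pqrt by simp
  show "\<P>(\<omega> in M. measure (\<xi> \<omega>) {p<..t} \<le> real k) \<le> (\<integral>\<omega>. ?g (\<xi> \<omega>) \<partial>M)"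
    unfolding prob_eq[OF pqrt(1)]
  proof (rule integral_mono[OF _ int])
    show "indicator {\<omega> \<in> space M. measure (\<xi> \<omega>) {p<..t} \<le> real k} \<omega> \<le> ?g (\<xi> \<omega>)" if "\<omega> \<in> space M" for \<omega>
      using soft_at_most_trapezoid_bounds(1)[OF point_processD(2)[OF \<xi> that] pqrt, of k] that
      by (simp add: indicator_def)
  qed (use ev[OF pqrt(1)] in \<open>simp add: emeasure_eq_measure\<close>)
  show "(\<integral>\<omega>. ?g (\<xi> \<omega>) \<partial>M) \<le> \<P>(\<omega> in M. measure (\<xi> \<omega>) {q<..r} \<le> real k)"
    unfolding prob_eq[OF q]
  proof (rule integral_mono[OF int])
    show "?g (\<xi> \<omega>) \<le> indicator {\<omega> \<in> space M. measure (\<xi> \<omega>) {q<..r} \<le> real k} \<omega>" if "\<omega> \<in> space M" for \<omega>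
      using soft_at_most_trapezoid_bounds(2)[OF point_processD(2)[OF \<xi> that] pqrt, of k] that
      by (simp add: indicator_def)
  qed (use ev[OF q] in \<open>simp add: emeasure_eq_measure\<close>)
qed

lemma poisson_process_at_most:
  assumes \<eta>: "poisson_process N {0<..} (scale_invariant_intensity c) \<eta>"
    and "0 < a" "a \<le> b" "0 < c"
  shows "\<P>(\<omega> in N. measure (\<eta> \<omega>) {a<..b} \<le> real k) =
    (\<Sum>i\<le>k. (c * ln (b / a)) ^ i / fact i * exp (- (c * ln (b / a))))"
proof -
  note pp = poisson_processD(1)[OF \<eta>]
  interpret prob_space N by (rule point_processD(1)[OF pp])
  define E where "E i = {\<omega> \<in> space N. emeasure (\<eta> \<omega>) {a<..b} = of_nat i}" for i
  have [measurable]: "(\<lambda>\<omega>. emeasure (\<eta> \<omega>) {a<..b}) \<in> borel_measurable N"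
    by (rule point_processD(3)[OF pp relcompact_borelD[OF relcompact_interval[OF \<open>0 < a\<close>]]])
  have E_sets: "E i \<in> sets N" for i unfolding E_def by measurable
  have "measure (\<eta> \<omega>) {a<..b} \<le> real k \<longleftrightarrow> (\<exists>i\<in>{..k}. emeasure (\<eta> \<omega>) {a<..b} = of_nat i)"
    if "\<omega> \<in> space N" for \<omega>
    using counting_measure_of_nat[OF point_processD(2)[OF pp that] relcompact_interval[OF \<open>0 < a\<close>, of b]]
    by (metis atMost_iff of_nat_eq_iff of_nat_le_iff)
  then have "{\<omega> \<in> space N. measure (\<eta> \<omega>) {a<..b} \<le> real k} = (\<Union>i\<in>{..k}. E i)"
    by (auto simp: E_def)
  then have "\<P>(\<omega> in N. measure (\<eta> \<omega>) {a<..b} \<le> real k) = prob (\<Union>i\<in>{..k}. E i)" by simp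
  also have "\<dots> = (\<Sum>i\<le>k. prob (E i))"
  proof (rule finite_measure_finite_Union)
    show "disjoint_family_on E {..k}" by (auto simp: disjoint_family_on_def E_def)
  qed (use E_sets in auto)
  finally show ?thesis unfolding E_def poisson_process_interval[OF assms] .
qed

text \<open>
  The sandwich loses a factor \<open>s > 1\<close> at each end point of the interval. The Poisson probabilities
  of the limit are continuous in the end points, so the loss vanishes as \<open>s\<close> tends to \<open>1\<close>.
\<close>

lemma convergence_at_most:
  fixes \<xi> :: "nat \<Rightarrow> 'v \<Rightarrow> real measure"
  assumes conv: "converges_vaguely_in_distribution {0<..} M \<xi> N \<eta>"
    and \<xi>: "\<And>n. point_process (M n) {0<..} (\<xi> n)"
    and \<eta>: "poisson_process N {0<..} (scale_invariant_intensity c) \<eta>" and c: "0 < c" and ab: "0 < a" "a < b"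
  shows "(\<lambda>n. \<P>(\<omega> in M n. measure (\<xi> n \<omega>) {a<..b} \<le> real k)) \<longlonglongrightarrow>
    (\<Sum>i\<le>k. (c * ln (b / a)) ^ i / fact i * exp (- (c * ln (b / a))))"
proof -
  define G where "G y = (\<Sum>i\<le>k. (c * ln y) ^ i / fact i * exp (- (c * ln y)))" for y
  note pp = poisson_processD(1)[OF \<eta>]
  have limE: "(\<lambda>n. \<integral>\<omega>. soft_at_most k (\<integral>x. trapezoid p q r t x \<partial>\<xi> n \<omega>) \<partial>M n) \<longlonglongrightarrow>
      (\<integral>\<omega>. soft_at_most k (\<integral>x. trapezoid p q r t x \<partial>\<eta> \<omega>) \<partial>N)" if "0 < p" "p < q" "r < t" for p q r t
  proof -
    have "bounded ((\<lambda>\<mu>. soft_at_most k (\<integral>x. trapezoid p q r t x \<partial>\<mu>)) ` locally_finite_measures {0<..})"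
      unfolding bounded_real by (auto simp: soft_at_most_def intro!: exI[of _ 1])
    then show ?thesis
      using conv continuous_map_soft_at_most_trapezoid[OF that]
      unfolding converges_vaguely_in_distribution_def by blast
  qed
  have G_eq: "\<P>(\<omega> in N. measure (\<eta> \<omega>) {p<..t} \<le> real k) = G (t / p)" if "0 < p" "p \<le> t" for p t
    unfolding G_def by (rule poisson_process_at_most[OF \<eta> that c])
  have G_tendsto: "((\<lambda>s. G (h s)) \<longlongrightarrow> G (b / a)) (at_right 1)" if "(h \<longlongrightarrow> b / a) (at_right 1)" for h :: "real \<Rightarrow> real"
    unfolding G_def using ab that by (intro tendsto_intros) auto
  have h1: "((\<lambda>s::real. (b * s) / (a / s)) \<longlongrightarrow> b / a) (at_right 1)"
    and h2: "((\<lambda>s::real. (b / s) / (a * s)) \<longlongrightarrow> b / a) (at_right 1)"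
    using ab by (auto intro!: tendsto_eq_intros)
  show ?thesis
    unfolding G_def[symmetric]
  proof (rule order_tendstoI)
    fix y assume "y < G (b / a)"
    then have "eventually (\<lambda>s. y < G ((b * s) / (a / s)) \<and> 1 < s) (at_right (1::real))"
      using order_tendstoD(1)[OF G_tendsto[OF h1]] eventually_at_right_less[of "1::real"]
      by (intro eventually_conj) auto
    then obtain s :: real where s: "y < G ((b * s) / (a / s))" "1 < s"
      using eventually_happens[of _ "at_right (1::real)"] by auto
    have pqrt: "0 < a / s" "a / s < a" "b < b * s" "a / s \<le> b * s"
    proof -
      show "0 < a / s" using ab s by simp
      show 1: "a / s < a" using ab s by (simp add: pos_divide_less_eq)
      show 2: "b < b * s" using ab s by simp
      show "a / s \<le> b * s" using 1 2 ab by linarith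
    qed
    have "y < (\<integral>\<omega>. soft_at_most k (\<integral>x. trapezoid (a / s) a b (b * s) x \<partial>\<eta> \<omega>) \<partial>N)"
      using expectation_soft_at_most_trapezoid(1)[OF pp pqrt(1-3), of k] G_eq[OF pqrt(1,4)] s(1) by simp
    from order_tendstoD(1)[OF limE[OF pqrt(1-3)] this]
    show "eventually (\<lambda>n. y < \<P>(\<omega> in M n. measure (\<xi> n \<omega>) {a<..b} \<le> real k)) sequentially"
    proof eventually_elim
      case (elim n)
      then show ?case using expectation_soft_at_most_trapezoid(2)[OF \<xi> pqrt(1-3), of n k] by simp
    qed
  next
    fix y assume "G (b / a) < y"
    moreover have "eventually (\<lambda>s::real. a * s < b / s) (at_right 1)"
    proof -
      have "((\<lambda>s::real. b / s - a * s) \<longlongrightarrow> b - a) (at_right 1)" by (auto intro!: tendsto_eq_intros)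
      then have "eventually (\<lambda>s::real. 0 < b / s - a * s) (at_right 1)"
        by (rule order_tendstoD(1)) (use ab in simp)
      then show ?thesis by eventually_elim simp
    qed
    ultimately have "eventually (\<lambda>s. G ((b / s) / (a * s)) < y \<and> a * s < b / s \<and> 1 < s) (at_right (1::real))"
      using order_tendstoD(2)[OF G_tendsto[OF h2]] eventually_at_right_less[of "1::real"]
      by (intro eventually_conj) auto
    then obtain s :: real where s: "G ((b / s) / (a * s)) < y" "a * s < b / s" "1 < s"
      using eventually_happens[of _ "at_right (1::real)"] by auto
    have pqrt: "0 < a" "a < a * s" "b / s < b" "0 < a * s" "a * s \<le> b / s"
    proof -
      show "b / s < b" using ab s by (simp add: pos_divide_less_eq)
    qed (use ab s in auto)
    have "(\<integral>\<omega>. soft_at_most k (\<integral>x. trapezoid a (a * s) (b / s) b x \<partial>\<eta> \<omega>) \<partial>N) < y"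
      using expectation_soft_at_most_trapezoid(2)[OF pp pqrt(1-3), of k] G_eq[OF pqrt(4,5)] s(1) by simp
    from order_tendstoD(2)[OF limE[OF pqrt(1-3)] this]
    show "eventually (\<lambda>n. \<P>(\<omega> in M n. measure (\<xi> n \<omega>) {a<..b} \<le> real k) < y) sequentially"
    proof eventually_elim
      case (elim n)
      then show ?case using expectation_soft_at_most_trapezoid(1)[OF \<xi> pqrt(1-3), of n k] by simp
    qed
  qed
qed

text \<open>
  Convergence for at most \<open>0\<close> and at most \<open>1\<close> points gives the void probability, which is the
  product in the first condition, and by subtraction the probability of exactly one point. Dividing the latter by the
  former shows that the sums in the second condition even converge to \<open>c * ln (b / a)\<close>.
\<close>

lemma poisson_limit_condition_if_converges_vaguely:
  assumes M: "prob_space M" and z: "filterlim z at_top sequentially" "\<And>k. 0 < z k"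
    and ind: "prob_space.indep_vars M (\<lambda>_. count_space UNIV) X UNIV"
    and c: "0 < c" and \<eta>: "poisson_process N {0<..} (scale_invariant_intensity c) \<eta>"
    and conv: "converges_vaguely_in_distribution {0<..} (\<lambda>_. M) (scaled_process z X) N \<eta>"
  shows "poisson_limit_condition M z X c"
  unfolding poisson_limit_condition_def
proof (intro allI impI, elim conjE)
  fix a b :: real assume ab: "0 < a" "a < b"
  interpret prob_space M by (rule M)
  have X [measurable]: "X k \<in> measurable M (count_space UNIV)" for k
    using ind by (auto simp: indep_vars_def)
  define A where "A n = {k. a * z n < z k \<and> z k \<le> b * z n}" for n
  define p where "p n = (\<Prod>k\<in>A n. \<P>(\<omega> in M. X k \<omega> = 0))" for n
  define s where "s n = (\<Sum>k\<in>A n. \<P>(\<omega> in M. X k \<omega> = 1) / \<P>(\<omega> in M. X k \<omega> = 0))" for n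
  define r where "r = c * ln (b / a)"
  have A: "finite (A n)" for n unfolding A_def by (rule scaled_process_interval(3)[OF z ab(1)])
  have indA: "indep_vars (\<lambda>_. count_space UNIV) X (A n)" for n by (rule indep_vars_subset[OF ind]) simp
  have at_most: "(\<lambda>n. \<P>(\<omega> in M. (\<Sum>k\<in>A n. X k \<omega>) \<le> k)) \<longlonglongrightarrow> (\<Sum>i\<le>k. r ^ i / fact i * exp (- r))" for k
    using convergence_at_most[OF conv point_process_scaled_process[OF z M X] \<eta> c ab, of k]
    unfolding scaled_process_interval(2)[OF z ab(1)] A_def r_def by (simp del: of_nat_sum)
  have p0: "p n = \<P>(\<omega> in M. (\<Sum>k\<in>A n. X k \<omega>) \<le> 0)" for n
    using prob_sum_eq_0[OF indA A, of n] by (simp add: p_def)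
  have p: "p \<longlonglongrightarrow> exp (- r)" using at_most[of 0] by (simp add: p0[abs_def])
  have "\<P>(\<omega> in M. (\<Sum>k\<in>A n. X k \<omega>) = 1) = \<P>(\<omega> in M. (\<Sum>k\<in>A n. X k \<omega>) \<le> 1) - p n" for n
  proof -
    have "\<P>(\<omega> in M. (\<Sum>k\<in>A n. X k \<omega>) \<le> 1) = \<P>(\<omega> in M. (\<Sum>k\<in>A n. X k \<omega>) \<le> 0) + \<P>(\<omega> in M. (\<Sum>k\<in>A n. X k \<omega>) = 1)"
      by (subst finite_measure_Union[symmetric]) (auto intro!: arg_cong[where f=prob])
    then show ?thesis by (simp add: p0)
  qed
  then have one: "(\<lambda>n. \<P>(\<omega> in M. (\<Sum>k\<in>A n. X k \<omega>) = 1)) \<longlonglongrightarrow> r * exp (- r)"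
    using tendsto_diff[OF at_most[of 1] p] by simp
  have "(\<lambda>n. \<P>(\<omega> in M. (\<Sum>k\<in>A n. X k \<omega>) = 1) / p n) \<longlonglongrightarrow> r * exp (- r) / exp (- r)"
    by (intro tendsto_divide one p) simp
  moreover have "eventually (\<lambda>n. \<P>(\<omega> in M. (\<Sum>k\<in>A n. X k \<omega>) = 1) / p n = s n) sequentially"
  proof -
    have "eventually (\<lambda>n. p n > 0) sequentially" using p by (rule order_tendstoD) simp
    then show ?thesis
    proof eventually_elim
      case (elim n)
      then have "\<P>(\<omega> in M. (\<Sum>k\<in>A n. X k \<omega>) = 1) = p n * s n"
        unfolding p_def s_def by (intro prob_sum_eq_1[OF indA A]) simp
      then show ?case using elim by simp
    qed
  qed
  ultimately have "s \<longlonglongrightarrow> r" by (simp add: filterlim_cong)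
  then have "liminf (\<lambda>n. ereal (s n)) = ereal r" by (intro lim_imp_Liminf) auto
  moreover have "exp (- r) = (a / b) powr c"
    using ab by (simp add: powr_def r_def ln_div algebra_simps)
  ultimately show "(\<lambda>n. \<Prod>k | a * z n < z k \<and> z k \<le> b * z n. \<P>(\<omega> in M. X k \<omega> = 0)) \<longlonglongrightarrow> (a / b) powr c \<and>
      ereal (c * ln (b / a)) \<le> liminf (\<lambda>n. ereal (\<Sum>k | a * z n < z k \<and> z k \<le> b * z n.
        \<P>(\<omega> in M. X k \<omega> = 1) / \<P>(\<omega> in M. X k \<omega> = 0)))"
    using p by (simp add: p_def[abs_def] s_def A_def r_def)
qed

section \<open>The characterisation\<close>

theorem theorem3p2:
  fixes M :: "'v measure" and z :: "nat \<Rightarrow> real" and X :: "nat \<Rightarrow> 'v \<Rightarrow> nat"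
    and N :: "real \<Rightarrow> 'w measure" and \<eta> :: "real \<Rightarrow> 'w \<Rightarrow> real measure"
  assumes "prob_space M"
    and "\<And>k. 0 < z k"
    and "mono z"
    and "filterlim z at_top sequentially"
    and "prob_space.indep_vars M (\<lambda>_. count_space UNIV) X UNIV"
    and "\<And>c. 0 < c \<Longrightarrow> poisson_process (N c) {0<..} (scale_invariant_intensity c) (\<eta> c)"
  shows "((\<exists>c>0. converges_vaguely_in_distribution {0<..} (\<lambda>_. M) (scaled_process z X) (N c) (\<eta> c))
            \<longleftrightarrow> (\<exists>c>0. poisson_limit_condition M z X c)) \<and>
         (\<forall>c>0. converges_vaguely_in_distribution {0<..} (\<lambda>_. M) (scaled_process z X) (N c) (\<eta> c)
            \<longleftrightarrow> poisson_limit_condition M z X c)"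
proof -
  have "converges_vaguely_in_distribution {0<..} (\<lambda>_. M) (scaled_process z X) (N c) (\<eta> c)
      \<longleftrightarrow> poisson_limit_condition M z X c" if c: "0 < c" for c
    using converges_vaguely_if_poisson_limit_condition[OF assms(1,4,2,5) c assms(6)[OF c]]
      poisson_limit_condition_if_converges_vaguely[OF assms(1,4,2,5) c assms(6)[OF c]]
    by blast
  then show ?thesis by blast
qed

end
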